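(* Let $a\ge 1$, $b\ge 0$ be integers and let $\nu=NE^{\nu_1}NE^{\nu_2}\cdots NE^{\nu_a}$ be the lattice path from $(0,0)$ to $(b,a)$ associated to the pair $(I,\overline{J})$. The length-framed triangulation of $\mathcal{F}_{\mathrm{car}(\nu)}$ is a geometric realization of the $(I,\overline{J})$-Tamari complex of dimension $a+b$ in $\mathbb{R}^{a+b+3}$.
   Context: Lattice paths use north steps $N=(0,1)$ and east steps $E=(1,0)$. Here $\nu=NE^{\nu_1}\cdots NE^{\nu_a}$ with integers $\nu_i\ge 0$ and $\sum_i \nu_i=b$. **The complex.** Let $\overline{\nu}=E\nu N$, a word of length $k=a+b+2$. The pair $(I,\overline{J})$ associated to $\nu$ is the bipartition $I\sqcup\overline{J}=\{1,\dots,k\}$ where $I$ is the set of positions of $E$ steps in $\overline\nu$ and $\overline{J}$ the set of positions of $N$ steps (so $1\in I$, $k\in\overline{J}$). The $(I,\overline{J})$-Tamari complex is the flag simplicial complex on the vertex set $\{(i,\overline{j})\in I\times\overline{J}: i<\overline{j}\}$ (comparing positions) whose minimal non-faces are the pairs $\{(i,\overline{j}),(i',\overline{j}')\}$ with $i<i'<j<j'$. A geometric realization of it is a geometric simplicial complex isomorphic to it as an abstract simplicial complex. **Graph and polytope.** The $\nu$-caracol graph $\mathrm{car}(\nu)$ is the directed multigraph on the vertex set $\{1,\dots,a+3\}$, all edges $(i,j)$ directed from $i$ to $j$ with $i<j$, having exactly these edges: $\nu_i$ copies of $(1,i+2)$ for $i=1,\dots,a$; one edge $(i,a+3)$ for each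 $i=2,\dots,a+1$; one edge $(i,i+1)$ for each $i=1,\dots,a+2$. Write $n+1=a+3$. The flow polytope $\mathcal{F}_{\mathrm{car}(\nu)}$ is the set of nonnegative real tuples $(x_e)_e$, indexed by the edges $e$ of $\mathrm{car}(\nu)$, with $\sum_{e\in \mathrm{out}(1)}x_e=1$ and $\sum_{e\in\mathrm{out}(j)}x_e=\sum_{e\in\mathrm{in}(j)}x_e$ for $j=2,\dots,n$, where $\mathrm{in}(j)$ and $\mathrm{out}(j)$ are the sets of incoming and outgoing edges at $j$. A route is a directed path from $1$ to $n+1$; the vertices of $\mathcal{F}_{\mathrm{car}(\nu)}$ are the indicator vectors of routes. **Framings and framed triangulations.** Inner vertices are $2,\dots,n$. A framing is a choice, at every inner vertex $i$, of linear orders $\prec_{\mathrm{in}(i)}$ and $\prec_{\mathrm{out}(i)}$ on the sets of incoming and outgoing edges at $i$. For distinct directed paths $P,Q$ from $1$ to $i$, let $j\le i$ be the smallest vertex after which $P$ and $Q$ coincide, and put $P\prec Q$ iff the edge of $P$ entering $j$ precedes the edge of $Q$ entering $j$ in $\prec_{\mathrm{in}(j)}$. For distinct directed paths $P,Q$ from $i$ to $n+1$, let $j\ge i$ be the largest vertex before which they coincide, and put $P\prec Q$ iff the edge of $P$ leaving $j$ precedes the edge of $Q$ leaving $j$ in $\prec_{\mathrm{out}(j)}$. For a route $R$ through $i$, $Ri$ and $iR$ denote the subpaths of $R$ ending, respectively beginning, at $i$. Routes $R,Q$ through $i$ are coherent at $i$ if $Ri,Qi$ are ordered the same as $iR,iQ$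 (i.e. it is not the case that one of the pairs is strictly ordered one way and the other pair strictly ordered the opposite way; equal subpaths cause no conflict). Routes are coherent if they are coherent at every common inner vertex. A clique is a set of mutually coherent routes; for a maximal clique $C$, $\Delta_C$ is the convex hull of the vertices of the flow polytope corresponding to routes in $C$. The framed triangulation is the one with top-dimensional simplices $\{\Delta_C : C \text{ a maximal clique}\}$ (together with all their faces). **Length framing.** The copies of each multiedge are labelled $1,2,\dots$. The length of edge $(i,j)$ is $j-i$. In the length framing, at each inner vertex, both among incoming and among outgoing edges, longer edges precede shorter ones, and parallel edges with smaller labels precede those with larger labels. The length-framed triangulation is the framed triangulation for this framing.
   Formalization: As defined, the polytope lies in R^{2a+b+2} (one coordinate per edge), which is R^{a+b+3} only for a=1; the realization is proved there, and in R^{a+b+3} after forgetting a-1 edge coordinates, a projection injective on the affine hull of the polytope. *)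

theory Defs
  imports "HOL-Analysis.Analysis" "Graph_Theory.Arc_Walk"
begin

section \<open>Abstract simplicial complexes and geometric realizations\<close>

text \<open>
  An abstract simplicial complex is given by its set of faces (the empty face included); its
  vertices are the elements of its faces.
\<close>

definition complex_isomorphic :: "'a set set \<Rightarrow> 'b set set \<Rightarrow> bool" where
  "complex_isomorphic K L \<longleftrightarrow>
     (\<exists>\<phi>. bij_betw \<phi> (\<Union>K) (\<Union>L) \<and> (\<forall>A \<subseteq> \<Union>K. A \<in> K \<longleftrightarrow> \<phi> ` A \<in> L))"

definition complex_dim :: "'a set set \<Rightarrow> int" where
  "complex_dim K = int (Max (card ` K)) - 1"

definition vertex_scheme :: "'a::euclidean_space set set \<Rightarrow> 'a set set" where
  "vertex_scheme \<T> = (\<lambda>S. {v. v extreme_point_of S}) ` \<T>"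

definition geometric_realization :: "'a::euclidean_space set set \<Rightarrow> 'b set set \<Rightarrow> bool" where
  "geometric_realization \<T> K \<longleftrightarrow>
     simplicial_complex \<T> \<and> complex_isomorphic (vertex_scheme \<T>) K"


section \<open>The Tamari complex of a lattice path\<close>

definition tamari_complex :: "nat set \<Rightarrow> nat set \<Rightarrow> (nat \<times> nat) set set" where
  "tamari_complex I J =
     {A. A \<subseteq> {(i, j). i \<in> I \<and> j \<in> J \<and> i < j} \<and>
         \<not> (\<exists>i j i' j'. (i, j) \<in> A \<and> (i', j') \<in> A \<and> i < i' \<and> i' < j \<and> j < j')}"

datatype step = North | East

text \<open>The list \<open>\<nu> = [\<nu>\<^sub>1, \<dots>, \<nu>\<^sub>a]\<close> encodes the path \<open>N E\<^sup>\<nu>\<^sup>1 \<dots> N E\<^sup>\<nu>\<^sup>a\<close>.\<close>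

definition lattice_path :: "nat list \<Rightarrow> step list" where
  "lattice_path \<nu> = concat (map (\<lambda>m. North # replicate m East) \<nu>)"

definition extended_path :: "nat list \<Rightarrow> step list" where
  "extended_path \<nu> = East # lattice_path \<nu> @ [North]"

text \<open>Positions are counted from 1, whereas list indices start at 0.\<close>

definition step_positions :: "step \<Rightarrow> step list \<Rightarrow> nat set" where
  "step_positions s w = {p. 1 \<le> p \<and> p \<le> length w \<and> w ! (p - 1) = s}"

definition path_I :: "nat list \<Rightarrow> nat set" where
  "path_I \<nu> = step_positions East (extended_path \<nu>)"

definition path_J :: "nat list \<Rightarrow> nat set" where
  "path_J \<nu> = step_positions North (extended_path \<nu>)"


section \<open>Flow polytopes and framed triangulations\<close>

text \<open>
  Below, \<open>G\<close> is a directed multigraph whose edges are all the elements of a finite type \<open>'e\<close>, so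
  that real tuples indexed by the edges are the vectors of \<open>real^'e\<close>. The vertices \<open>s\<close> and \<open>t\<close>
  are the source and the sink.
\<close>

definition inner_verts :: "('a, 'e) pre_digraph \<Rightarrow> 'a \<Rightarrow> 'a \<Rightarrow> 'a set" where
  "inner_verts G s t = verts G - {s, t}"

definition flow_polytope :: "('a, 'e::finite) pre_digraph \<Rightarrow> 'a \<Rightarrow> 'a \<Rightarrow> (real^'e) set" where
  "flow_polytope G s t =
     {x. (\<forall>e. 0 \<le> x $ e) \<and> (\<Sum>e\<in>out_arcs G s. x $ e) = 1 \<and>
         (\<forall>j\<in>inner_verts G s t. (\<Sum>e\<in>out_arcs G j. x $ e) = (\<Sum>e\<in>in_arcs G j. x $ e))}"

text \<open>A path is represented by its list of edges, in order.\<close>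

definition routes :: "('a, 'e) pre_digraph \<Rightarrow> 'a \<Rightarrow> 'a \<Rightarrow> 'e list set" where
  "routes G s t = {R. pre_digraph.apath G s R t}"

definition route_vector :: "'e list \<Rightarrow> real^'e::finite" where
  "route_vector R = (\<chi> e. if e \<in> set R then 1 else 0)"

text \<open>
  A framing consists of two families of strict linear orders: \<open>(e, f) \<in> fin i\<close> (respectively
  \<open>fout i\<close>) means that \<open>e\<close> strictly precedes \<open>f\<close> among the edges entering (leaving) \<open>i\<close>.
\<close>

definition framing ::
    "('a, 'e) pre_digraph \<Rightarrow> 'a \<Rightarrow> 'a \<Rightarrow> ('a \<Rightarrow> 'e rel) \<Rightarrow> ('a \<Rightarrow> 'e rel) \<Rightarrow> bool" where
  "framing G s t fin fout \<longleftrightarrow>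
     (\<forall>i\<in>inner_verts G s t.
        strict_linear_order_on (in_arcs G i) (fin i) \<and>
        strict_linear_order_on (out_arcs G i) (fout i))"

text \<open>
  In the next definition \<open>P\<close> and \<open>Q\<close> are paths with a common start and a common end \<open>i\<close>. Their
  longest common final part is \<open>S\<close>, and \<open>e\<close>, \<open>f\<close> are the edges by which they enter the vertex at
  which \<open>S\<close> starts (which is \<open>i\<close> itself if \<open>S\<close> is empty). The definition after it is symmetric,
  with \<open>S\<close> the longest common initial part.
\<close>

definition prec_in ::
    "('a, 'e) pre_digraph \<Rightarrow> ('a \<Rightarrow> 'e rel) \<Rightarrow> 'e list \<Rightarrow> 'e list \<Rightarrow> bool" where
  "prec_in G fin P Q \<longleftrightarrow>
     (\<exists>P' Q' e f S. P = P' @ e # S \<and> Q = Q' @ f # S \<and> e \<noteq> f \<and> (e, f) \<in> fin (head G e))"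

definition prec_out ::
    "('a, 'e) pre_digraph \<Rightarrow> ('a \<Rightarrow> 'e rel) \<Rightarrow> 'e list \<Rightarrow> 'e list \<Rightarrow> bool" where
  "prec_out G fout P Q \<longleftrightarrow>
     (\<exists>P' Q' e f S. P = S @ e # P' \<and> Q = S @ f # Q' \<and> e \<noteq> f \<and> (e, f) \<in> fout (tail G e))"

text \<open>For a path \<open>R\<close> through \<open>i\<close>, these are the subpaths \<open>Ri\<close> and \<open>iR\<close>.\<close>

definition path_to :: "('a, 'e) pre_digraph \<Rightarrow> 'a \<Rightarrow> 'e list \<Rightarrow> 'e list" where
  "path_to G i R = takeWhile (\<lambda>e. tail G e \<noteq> i) R"

definition path_from :: "('a, 'e) pre_digraph \<Rightarrow> 'a \<Rightarrow> 'e list \<Rightarrow> 'e list" where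
  "path_from G i R = dropWhile (\<lambda>e. tail G e \<noteq> i) R"

definition coherent_at ::
    "('a, 'e) pre_digraph \<Rightarrow> ('a \<Rightarrow> 'e rel) \<Rightarrow> ('a \<Rightarrow> 'e rel) \<Rightarrow> 'a \<Rightarrow> 'e list \<Rightarrow> 'e list \<Rightarrow> bool" where
  "coherent_at G fin fout i R Q \<longleftrightarrow>
     \<not> (prec_in G fin (path_to G i R) (path_to G i Q) \<and>
        prec_out G fout (path_from G i Q) (path_from G i R)) \<and>
     \<not> (prec_in G fin (path_to G i Q) (path_to G i R) \<and>
        prec_out G fout (path_from G i R) (path_from G i Q))"

definition coherent ::
    "('a, 'e) pre_digraph \<Rightarrow> 'a \<Rightarrow> 'a \<Rightarrow> ('a \<Rightarrow> 'e rel) \<Rightarrow> ('a \<Rightarrow> 'e rel) \<Rightarrow>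
     'e list \<Rightarrow> 'e list \<Rightarrow> bool" where
  "coherent G s t fin fout R Q \<longleftrightarrow>
     (\<forall>i \<in> inner_verts G s t \<inter> set (pre_digraph.awalk_verts G s R)
                            \<inter> set (pre_digraph.awalk_verts G s Q).
        coherent_at G fin fout i R Q)"

definition clique ::
    "('a, 'e) pre_digraph \<Rightarrow> 'a \<Rightarrow> 'a \<Rightarrow> ('a \<Rightarrow> 'e rel) \<Rightarrow> ('a \<Rightarrow> 'e rel) \<Rightarrow>
     'e list set \<Rightarrow> bool" where
  "clique G s t fin fout C \<longleftrightarrow>
     C \<subseteq> routes G s t \<and> (\<forall>R\<in>C. \<forall>Q\<in>C. coherent G s t fin fout R Q)"

definition maximal_clique ::
    "('a, 'e) pre_digraph \<Rightarrow> 'a \<Rightarrow> 'a \<Rightarrow> ('a \<Rightarrow> 'e rel) \<Rightarrow> ('a \<Rightarrow> 'e rel) \<Rightarrow>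
     'e list set \<Rightarrow> bool" where
  "maximal_clique G s t fin fout C \<longleftrightarrow>
     clique G s t fin fout C \<and> (\<forall>D. clique G s t fin fout D \<and> C \<subseteq> D \<longrightarrow> D = C)"

definition clique_simplex :: "'e::finite list set \<Rightarrow> (real^'e) set" where
  "clique_simplex C = convex hull (route_vector ` C)"

definition framed_top_simplices ::
    "('a, 'e::finite) pre_digraph \<Rightarrow> 'a \<Rightarrow> 'a \<Rightarrow> ('a \<Rightarrow> 'e rel) \<Rightarrow> ('a \<Rightarrow> 'e rel) \<Rightarrow>
     (real^'e) set set" where
  "framed_top_simplices G s t fin fout =
     clique_simplex ` {C. maximal_clique G s t fin fout C}"

definition framed_triangulation ::
    "('a, 'e::finite) pre_digraph \<Rightarrow> 'a \<Rightarrow> 'a \<Rightarrow> ('a \<Rightarrow> 'e rel) \<Rightarrow> ('a \<Rightarrow> 'e rel) \<Rightarrow>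
     (real^'e) set set" where
  "framed_triangulation G s t fin fout =
     {S. \<exists>\<Delta> \<in> framed_top_simplices G s t fin fout. S face_of \<Delta>}"


section \<open>The caracol graph and the length framing\<close>

text \<open>An edge is described by its tail, its head and its label among the parallel edges.\<close>

definition caracol_edges :: "nat list \<Rightarrow> (nat \<times> nat \<times> nat) set" where
  "caracol_edges \<nu> = (let a = length \<nu> in
     {(1, i + 2, m) | i m. 1 \<le> i \<and> i \<le> a \<and> 1 \<le> m \<and> m \<le> \<nu> ! (i - 1)} \<union>
     {(i, a + 3, 1) | i. 2 \<le> i \<and> i \<le> a + 1} \<union>
     {(i, i + 1, 1) | i. 1 \<le> i \<and> i \<le> a + 2})"

text \<open>
  \<open>G\<close>, with edge labels \<open>lab\<close>, is the caracol graph of \<open>\<nu>\<close>, its edges being named by the elements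
  of the index type \<open>'e\<close>.
\<close>

definition is_caracol :: "nat list \<Rightarrow> (nat, 'e) pre_digraph \<Rightarrow> ('e \<Rightarrow> nat) \<Rightarrow> bool" where
  "is_caracol \<nu> G lab \<longleftrightarrow>
     verts G = {1..length \<nu> + 3} \<and> arcs G = UNIV \<and>
     bij_betw (\<lambda>e. (tail G e, head G e, lab e)) UNIV (caracol_edges \<nu>)"

definition length_order :: "(nat, 'e) pre_digraph \<Rightarrow> ('e \<Rightarrow> nat) \<Rightarrow> 'e set \<Rightarrow> 'e rel" where
  "length_order G lab A =
     {(e, f). e \<in> A \<and> f \<in> A \<and>
        (head G f - tail G f < head G e - tail G e \<or>
         tail G e = tail G f \<and> head G e = head G f \<and> lab e < lab f)}"

definition length_in :: "(nat, 'e) pre_digraph \<Rightarrow> ('e \<Rightarrow> nat) \<Rightarrow> nat \<Rightarrow> 'e rel" where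
  "length_in G lab i = length_order G lab (in_arcs G i)"

definition length_out :: "(nat, 'e) pre_digraph \<Rightarrow> ('e \<Rightarrow> nat) \<Rightarrow> nat \<Rightarrow> 'e rel" where
  "length_out G lab i = length_order G lab (out_arcs G i)"

lemma framing_length:
  assumes "is_caracol \<nu> G lab"
  shows "framing G 1 (length \<nu> + 3) (length_in G lab) (length_out G lab)"
proof -
  have mem: "(tail G e, head G e, lab e) \<in> caracol_edges \<nu>" for e
    using assms unfolding is_caracol_def bij_betw_def by blast
  have less: "tail G e < head G e" for e
    using mem[of e] unfolding caracol_edges_def Let_def by auto
  have inj: "e = f" if "tail G e = tail G f" "head G e = head G f" "lab e = lab f" for e f
    using assms that unfolding is_caracol_def bij_betw_def inj_def by simp
  have strict: "trans (length_order G lab A)" "irrefl (length_order G lab A)" for A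
    unfolding length_order_def trans_def irrefl_def by auto
  have "total_on (in_arcs G i) (length_in G lab i)" for i
  proof (rule total_onI)
    fix e f assume *: "e \<in> in_arcs G i" "f \<in> in_arcs G i" "e \<noteq> f"
    then have h: "head G e = i" "head G f = i" by auto
    show "(e, f) \<in> length_in G lab i \<or> (f, e) \<in> length_in G lab i"
      using * h less[of e] less[of f] inj[of e f]
      unfolding length_in_def length_order_def
      by (cases "tail G e" "tail G f" rule: linorder_cases;
          cases "lab e" "lab f" rule: linorder_cases) auto
  qed
  moreover have "total_on (out_arcs G i) (length_out G lab i)" for i
  proof (rule total_onI)
    fix e f assume *: "e \<in> out_arcs G i" "f \<in> out_arcs G i" "e \<noteq> f"
    then have h: "tail G e = i" "tail G f = i" by auto
    show "(e, f) \<in> length_out G lab i \<or> (f, e) \<in> length_out G lab i"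
      using * h less[of e] less[of f] inj[of e f]
      unfolding length_out_def length_order_def
      by (cases "head G e" "head G f" rule: linorder_cases;
          cases "lab e" "lab f" rule: linorder_cases) auto
  qed
  ultimately show ?thesis
    unfolding framing_def strict_linear_order_on_def length_in_def length_out_def
    using strict by blast
qed

definition length_framed_top_simplices ::
    "nat list \<Rightarrow> (nat, 'e::finite) pre_digraph \<Rightarrow> ('e \<Rightarrow> nat) \<Rightarrow> (real^'e) set set" where
  "length_framed_top_simplices \<nu> G lab =
     framed_top_simplices G 1 (length \<nu> + 3) (length_in G lab) (length_out G lab)"

definition length_framed_triangulation ::
    "nat list \<Rightarrow> (nat, 'e::finite) pre_digraph \<Rightarrow> ('e \<Rightarrow> nat) \<Rightarrow> (real^'e) set set" where
  "length_framed_triangulation \<nu> G lab =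
     framed_triangulation G 1 (length \<nu> + 3) (length_in G lab) (length_out G lab)"

text \<open>Projection onto the coordinates selected by \<open>c\<close>.\<close>

definition coord_proj :: "('d \<Rightarrow> 'e) \<Rightarrow> real^'e::finite \<Rightarrow> real^'d::finite" where
  "coord_proj c x = (\<chi> k. x $ c k)"

end

theory Submission
  imports Defs
begin

text \<open>
  A route of the caracol graph takes an edge \<open>e\<close> from \<open>1\<close> to an inner vertex, follows unit edges up to an
  inner vertex \<open>v\<close> and leaves from there for the sink. Sorted along the word \<open>E \<nu> N\<close>, the edges leaving
  the source are the east steps and the edges entering the sink are the north steps, and a pair of such
  edges belongs to a route if and only if the east step comes first. So routes are arcs \<open>(i, j)\<close> with
  \<open>i < j\<close>, the vertices of the Tamari complex. In the length framing, of two routes with a common inner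
  vertex, the one that starts at the later east step precedes the other one on the way in, because it
  arrives by an edge from \<open>1\<close> or by a parallel edge with a smaller label; the one that ends at the earlier
  north step precedes the other one on the way out. Hence two routes are incoherent exactly if their arcs
  cross, \<open>i < i' < j < j'\<close> (\<open>compatible_iff_noncrossing\<close>), and the cliques are the faces of the Tamari
  complex.

  That the cliques triangulate the flow polytope is a statement about stacks. By conservation, a flow
  is determined by its values \<open>x\<^sub>i\<close> on the source edges and \<open>y\<^sub>j\<close> on the sink edges, and to write it as a
  combination of routes means to match the supply \<open>x\<close> with the demand \<open>y\<close>, where each demand is met by
  earlier supplies. A noncrossing matching is one in which the most recent supply is used first. Such
  a matching exists, because nonnegativity of the flow on the unit edges says that supply never falls
  short of demand (\<open>noncrossing_matching_exists\<close>), and it is unique (\<open>noncrossing_matching_unique\<close>).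
  Existence says that the simplices cover the polytope. Uniqueness says that barycentric coordinates
  supported on faces are unique over the whole complex, which makes the hulls of the faces simplices
  that meet in common faces (\<open>hulls_realize\<close>).

  The dimension is combinatorial: a maximal noncrossing set of arcs on \<open>I\<close> and \<open>J\<close> has exactly
  \<open>card I + card J - 1\<close> elements, which is \<open>a + b + 1\<close> here (\<open>card_maximal_noncrossing\<close>). Finally, flows are
  separated by the \<open>a + b + 2\<close> coordinates of the source and sink edges, so the projection to these and
  one more coordinate is injective on the affine hull of the polytope and keeps barycentric coordinates
  unique.
\<close>

section \<open>Noncrossing sets of arcs\<close>

definition arcs_between :: "nat set \<Rightarrow> nat set \<Rightarrow> (nat \<times> nat) set" where
  "arcs_between I J = {(i, j). i \<in> I \<and> j \<in> J \<and> i < j}"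

lemma finite_arcs_between: "finite I \<Longrightarrow> finite J \<Longrightarrow> finite (arcs_between I J)"
  by (rule finite_subset[of _ "I \<times> J"]) (auto simp: arcs_between_def)

lemma tamari_complex_iff:
  "A \<in> tamari_complex I J \<longleftrightarrow> A \<subseteq> arcs_between I J \<and>
     (\<forall>i j i' j'. (i, j) \<in> A \<longrightarrow> (i', j') \<in> A \<longrightarrow> i < i' \<longrightarrow> i' < j \<longrightarrow> j < j' \<longrightarrow> False)"
  unfolding tamari_complex_def arcs_between_def by blast

lemma tamari_complex_subset:
  assumes "A \<in> tamari_complex I J" and "B \<subseteq> A"
  shows "B \<in> tamari_complex I J"
  using assms unfolding tamari_complex_iff by blast

lemma Union_tamari_complex: "\<Union>(tamari_complex I J) = arcs_between I J"
proof
  show "arcs_between I J \<subseteq> \<Union>(tamari_complex I J)"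
  proof
    fix p assume "p \<in> arcs_between I J"
    then have "{p} \<in> tamari_complex I J" unfolding tamari_complex_iff by auto
    then show "p \<in> \<Union>(tamari_complex I J)" by blast
  qed
qed (auto simp: tamari_complex_iff)

lemma finite_tamari_complex:
  assumes "finite I" and "finite J"
  shows "finite (tamari_complex I J)"
  by (rule finite_subset[of _ "Pow (arcs_between I J)"])
     (auto simp: tamari_complex_iff finite_arcs_between assms)

text \<open>
  Induction on \<open>I\<close>, removing its last element \<open>i\<^sub>0\<close>. Let \<open>m\<close> be the furthest partner of \<open>i\<^sub>0\<close>. By
  maximality the set \<open>D\<close> of partners of \<open>i\<^sub>0\<close> consists of all elements of \<open>J\<close> in \<open>(i\<^sub>0, m]\<close>, and an arc
  from an earlier \<open>i\<close> cannot end strictly between \<open>i\<^sub>0\<close> and \<open>m\<close>, as it would cross \<open>(i\<^sub>0, m)\<close>. So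
  deleting \<open>i\<^sub>0\<close> and \<open>D - {m}\<close>, which are \<open>card D\<close> points, deletes exactly the \<open>card D\<close> arcs at \<open>i\<^sub>0\<close>,
  and what is left is maximal for the remaining points. The elements \<open>i\<^sub>1\<close> and \<open>j\<^sub>1\<close> make sure that
  every point has a potential partner, and this is inherited by the smaller instance.
\<close>

lemma card_maximal_noncrossing:
  assumes "finite I" and "finite J"
    and "i1 \<in> I" "\<And>j. j \<in> J \<Longrightarrow> i1 < j"
    and "j1 \<in> J" "\<And>i. i \<in> I \<Longrightarrow> i < j1"
    and "A \<in> tamari_complex I J"
    and "\<And>B. B \<in> tamari_complex I J \<Longrightarrow> A \<subseteq> B \<Longrightarrow> B = A"
  shows "card A + 1 = card I + card J"
  using assms
proof (induction "card I" arbitrary: I J A i1 j1)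
  case 0
  then show ?case by auto
next
  case (Suc n)
  note A = \<open>A \<in> tamari_complex I J\<close>
  have AX: "A \<subseteq> arcs_between I J" using A by (simp add: tamari_complex_iff)
  have nc: False if "(i, j) \<in> A" "(i', j') \<in> A" "i < i'" "i' < j" "j < j'" for i j i' j'
    using A that unfolding tamari_complex_iff by blast
  have addable: "(i, j) \<in> A"
    if "(i, j) \<in> arcs_between I J"
      and *: "\<And>i' j'. (i', j') \<in> A \<Longrightarrow> \<not> (i < i' \<and> i' < j \<and> j < j') \<and> \<not> (i' < i \<and> i < j' \<and> j' < j)"
    for i j
  proof -
    have "insert (i, j) A \<in> tamari_complex I J"
      unfolding tamari_complex_iff
    proof (intro conjI allI impI)
      show "insert (i, j) A \<subseteq> arcs_between I J" using AX that(1) by blast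
      show False if "(x, y) \<in> insert (i, j) A" "(x', y') \<in> insert (i, j) A"
        "x < x'" "x' < y" "y < y'" for x y x' y'
        using that nc[of x y x' y'] *[of x y] *[of x' y'] by auto
    qed
    then show ?thesis using Suc.prems(8) by blast
  qed
  define i0 where "i0 = Max I"
  have i0: "i0 \<in> I" "\<And>i. i \<in> I \<Longrightarrow> i \<le> i0"
    using Suc.prems(1,3) by (auto simp: i0_def intro: Max_in)
  have i0j1: "i0 < j1" using i0 Suc.prems(6) by blast
  define D where "D = {j. (i0, j) \<in> A}"
  have DJ: "D \<subseteq> J" "\<And>j. j \<in> D \<Longrightarrow> i0 < j" using AX by (auto simp: D_def arcs_between_def)
  have finD: "finite D" using DJ(1) Suc.prems(2) finite_subset by blast
  have "D \<noteq> {}"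
  proof -
    define j where "j = Min {j \<in> J. i0 < j}"
    have ne: "{j \<in> J. i0 < j} \<noteq> {}" using i0j1 Suc.prems(5) by blast
    have j: "j \<in> J" "i0 < j" using Min_in[OF _ ne] Suc.prems(2) by (auto simp: j_def)
    have jmin: "j \<le> j'" if "j' \<in> J" "i0 < j'" for j'
      using that Suc.prems(2) by (auto simp: j_def)
    have "(i0, j) \<in> A"
    proof (rule addable)
      show "(i0, j) \<in> arcs_between I J" using i0 j by (simp add: arcs_between_def)
      show "\<not> (i0 < i' \<and> i' < j \<and> j < j') \<and> \<not> (i' < i0 \<and> i0 < j' \<and> j' < j)"
        if "(i', j') \<in> A" for i' j'
        using that AX i0(2)[of i'] jmin[of j'] by (auto simp: arcs_between_def)
    qed
    then show ?thesis by (auto simp: D_def)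
  qed
  define m where "m = Max D"
  have m: "m \<in> D" "\<And>j. j \<in> D \<Longrightarrow> j \<le> m"
    using finD \<open>D \<noteq> {}\<close> by (auto simp: m_def intro: Max_in)
  have mA: "(i0, m) \<in> A" and mJ: "m \<in> J" "i0 < m" using m(1) DJ by (auto simp: D_def)
  have Deq: "D = {j \<in> J. i0 < j \<and> j \<le> m}"
  proof
    show "{j \<in> J. i0 < j \<and> j \<le> m} \<subseteq> D"
    proof
      fix j assume j: "j \<in> {j \<in> J. i0 < j \<and> j \<le> m}"
      have "(i0, j) \<in> A"
      proof (rule addable)
        show "(i0, j) \<in> arcs_between I J" using i0 j by (simp add: arcs_between_def)
        show "\<not> (i0 < i' \<and> i' < j \<and> j < j') \<and> \<not> (i' < i0 \<and> i0 < j' \<and> j' < j)"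
          if "(i', j') \<in> A" for i' j'
          using that AX i0(2)[of i'] nc[OF that mA] j by (auto simp: arcs_between_def)
      qed
      then show "j \<in> D" by (simp add: D_def)
    qed
  qed (use DJ m in auto)
  define J' where "J' = J - (D - {m})"
  define I' where "I' = I - {i0}"
  define A' where "A' = A - Pair i0 ` D"
  have cardA: "card A = card A' + card D"
  proof -
    have "Pair i0 ` D \<subseteq> A" by (auto simp: D_def)
    moreover have "card (Pair i0 ` D) = card D" by (simp add: card_image inj_on_def)
    moreover have "finite A" using AX finite_arcs_between Suc.prems(1,2) finite_subset by blast
    ultimately show ?thesis unfolding A'_def
      by (metis card_Diff_subset card_mono finD finite_imageI le_add_diff_inverse2)
  qed
  have cardJ: "card J' + card D = card J + 1"
  proof -
    have "card (D - {m}) = card D - 1" "card D > 0"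
      using m(1) finD by (auto simp: card_gt_0_iff)
    moreover have "card J' = card J - card (D - {m})"
      unfolding J'_def by (rule card_Diff_subset) (use finD DJ in auto)
    moreover have "card (D - {m}) \<le> card J" by (rule card_mono) (use Suc.prems(2) DJ in auto)
    ultimately show ?thesis by linarith
  qed
  have cardI: "card I = card I' + 1" "card I' = n"
    using Suc.hyps(2) i0(1) Suc.prems(1) by (simp_all add: I'_def)
  show ?case
  proof (cases "I' = {}")
    case True
    then have I: "I = {i0}" using i0(1) by (auto simp: I'_def)
    then have "D = J"
    proof -
      have "(i0, j) \<in> A" if "j \<in> J" for j
        by (rule addable) (use that I Suc.prems(3,4) AX in \<open>auto simp: arcs_between_def\<close>)
      then show ?thesis using DJ(1) by (auto simp: D_def)
    qed
    moreover have "A' = {}" using AX I by (auto simp: A'_def D_def arcs_between_def)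
    ultimately show ?thesis using cardA I by simp
  next
    case False
    then obtain i2 where "i2 \<in> I'" by blast
    (* Of the points that remain, some element of I must lie below all of J: if i1 is the deleted
       point, then it was the last element of I, and any other element will do. *)
    define i3 where "i3 = (if i1 = i0 then i2 else i1)"
    have i3: "i3 \<in> I'" "\<And>j. j \<in> J \<Longrightarrow> i3 < j"
    proof -
      show "i3 \<in> I'" using \<open>i2 \<in> I'\<close> Suc.prems(3) by (simp add: i3_def I'_def)
      show "i3 < j" if "j \<in> J" for j
        using Suc.prems(4)[OF that] i0(2)[of i2] \<open>i2 \<in> I'\<close>
        by (simp add: i3_def I'_def split: if_splits)
    qed
    have end_remains: "j \<in> J'" if "(i, j) \<in> A" "i \<noteq> i0" for i j
    proof (rule ccontr)
      assume "j \<notin> J'"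
      then have "j \<in> D" "j \<noteq> m" using that AX by (auto simp: J'_def arcs_between_def)
      then have "i0 < j" "j < m" using DJ m(2)[of j] by auto
      moreover have "i < i0" using that AX i0(2)[of i] by (auto simp: arcs_between_def)
      ultimately show False using nc[OF that(1) mA] by simp
    qed
    have A'I: "i \<in> I'" "i < i0" "j \<in> J'" if "(i, j) \<in> A'" for i j
    proof -
      have *: "(i, j) \<in> A" "i \<noteq> i0" using that by (auto simp: A'_def D_def)
      then show "i \<in> I'" "i < i0" using AX i0(2)[of i] by (auto simp: I'_def arcs_between_def)
      show "j \<in> J'" using end_remains * .
    qed
    have "card A' + 1 = card I' + card J'"
    proof (rule Suc.hyps(1)[where ?i1.0=i3 and ?j1.0=m])
      show "n = card I'" "finite I'" "finite J'" "i3 \<in> I'"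
        using cardI Suc.prems(1,2) i3 by (simp_all add: I'_def J'_def)
      show "i3 < j" if "j \<in> J'" for j using that i3(2) by (simp add: J'_def)
      show "m \<in> J'" using mJ by (simp add: J'_def)
      show "i < m" if "i \<in> I'" for i using that i0(2)[of i] mJ by (simp add: I'_def)
      show "A' \<in> tamari_complex I' J'"
      proof -
        have "A' \<subseteq> A" by (auto simp: A'_def)
        then have "A' \<in> tamari_complex I J" using A tamari_complex_subset by blast
        moreover have "A' \<subseteq> arcs_between I' J'"
          using A'I \<open>A' \<subseteq> A\<close> AX by (auto simp: arcs_between_def)
        ultimately show ?thesis unfolding tamari_complex_iff by blast
      qed
      show "B = A'" if B: "B \<in> tamari_complex I' J'" "A' \<subseteq> B" for B
      proof -
        have "(i, j) \<in> A'" if "(i, j) \<in> B" for i j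
        proof -
          have ij: "i \<in> I'" "j \<in> J'" "i < j"
            using that B(1) by (auto simp: tamari_complex_iff arcs_between_def)
          then have ii: "i \<in> I" "i \<noteq> i0" "j \<in> J" "j \<in> D \<Longrightarrow> j = m" "i < i0"
            using i0(2)[of i] by (auto simp: I'_def J'_def)
          have "(i, j) \<in> A"
          proof (rule addable)
            show "(i, j) \<in> arcs_between I J" using ij(3) ii(1,3) by (simp add: arcs_between_def)
            fix i' j' assume a: "(i', j') \<in> A"
            show "\<not> (i < i' \<and> i' < j \<and> j < j') \<and> \<not> (i' < i \<and> i < j' \<and> j' < j)"
            proof (cases "i' = i0")
              case True
              then have "j' \<le> m" "i < i'" using a m(2) ii(5) by (simp_all add: D_def)
              moreover have "j = m \<or> j \<le> i0 \<or> m < j" using ii(3,4) Deq by force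
              ultimately show ?thesis using True by auto
            next
              case False
              then have "(i', j') \<in> B" using a B(2) by (auto simp: A'_def)
              with that show ?thesis using B(1) unfolding tamari_complex_iff by meson
            qed
          qed
          then show ?thesis using ii by (auto simp: A'_def)
        qed
        then show ?thesis using B(2) by auto
      qed
    qed
    then show ?thesis using cardA cardJ cardI by linarith
  qed
qed

section \<open>Noncrossing matchings of a supply with a demand\<close>

lemma sum_fun_upd_add:
  fixes f :: "'a \<Rightarrow> real"
  assumes "finite S"
  shows "sum (f(p := f p + t)) S = sum f S + (if p \<in> S then t else 0)"
proof -
  have "f(p := f p + t) = (\<lambda>q. f q + (if q = p then t else 0))" by auto
  then show ?thesis using assms by (simp add: sum.distrib)
qed

lemma equal_sums_compensate:
  fixes u w :: "'a \<Rightarrow> real"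
  assumes "finite S" and "sum u S = sum w S" and "p \<in> S" and "u p < w p"
  shows "\<exists>q\<in>S. w q < u q"
proof (rule ccontr)
  assume "\<not> (\<exists>q\<in>S. w q < u q)"
  then have "\<forall>q\<in>S. u q \<le> w q" by auto
  then have "sum u S < sum w S" using assms by (intro sum_strict_mono_ex1) auto
  then show False using assms(2) by simp
qed

text \<open>
  If \<open>u\<close> and \<open>w\<close> have the same row and column sums but differ, take the first column \<open>j\<close> in which
  they differ and the last row \<open>i\<close> in which they differ within that column. The smaller one of the
  two values at \<open>(i, j)\<close> must be made up for later in row \<open>i\<close> and earlier in column \<open>j\<close>, and the two
  arcs that do so cross.
\<close>

lemma noncrossing_matching_unique:
  fixes u w :: "nat \<times> nat \<Rightarrow> real" and I J :: "nat set"
  defines "X \<equiv> arcs_between I J"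
  assumes fin: "finite I" "finite J"
    and nonneg: "\<And>p. p \<in> X \<Longrightarrow> 0 \<le> u p" "\<And>p. p \<in> X \<Longrightarrow> 0 \<le> w p"
    and supp: "{p \<in> X. u p \<noteq> 0} \<in> tamari_complex I J" "{p \<in> X. w p \<noteq> 0} \<in> tamari_complex I J"
    and rows: "\<And>i. i \<in> I \<Longrightarrow> sum u {p \<in> X. fst p = i} = sum w {p \<in> X. fst p = i}"
    and cols: "\<And>j. j \<in> J \<Longrightarrow> sum u {p \<in> X. snd p = j} = sum w {p \<in> X. snd p = j}"
    and "p \<in> X"
  shows "u p = w p"
proof (rule ccontr)
  have finX: "finite X" using fin by (simp add: X_def finite_arcs_between)
  define D where "D = {p \<in> X. u p \<noteq> w p}"
  assume "u p \<noteq> w p"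
  with \<open>p \<in> X\<close> have Dne: "snd ` D \<noteq> {}" unfolding D_def by blast
  have finD: "finite D" using finX by (simp add: D_def)
  define j where "j = Min (snd ` D)"
  have "j \<in> snd ` D" using Min_in[OF _ Dne] finD by (simp add: j_def)
  then have ne: "{i. (i, j) \<in> D} \<noteq> {}" by force
  have fini: "finite {i. (i, j) \<in> D}"
    by (rule finite_subset[of _ "fst ` D"]) (use finD in force)+
  define i where "i = Max {i. (i, j) \<in> D}"
  have ij: "(i, j) \<in> D" using Max_in[OF fini ne] by (simp add: i_def)
  have jmin: "u (i', j') = w (i', j')" if "(i', j') \<in> X" "j' < j" for i' j'
  proof (rule ccontr)
    assume "u (i', j') \<noteq> w (i', j')"
    then have "j' \<in> snd ` D" using that by (force simp: D_def)
    then have "j \<le> j'" unfolding j_def using finD by (intro Min_le) auto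
    then show False using that by simp
  qed
  have imax: "u (i', j) = w (i', j)" if "(i', j) \<in> X" "i < i'" for i'
  proof (rule ccontr)
    assume "u (i', j) \<noteq> w (i', j)"
    then have "i' \<in> {i. (i, j) \<in> D}" using that by (simp add: D_def)
    then have "i' \<le> i" unfolding i_def using fini by (intro Max_ge)
    then show False using that by simp
  qed
  have crossing: False
    if lt: "f (i, j) < g (i, j)"
      and "{p \<in> X. f p \<noteq> 0} \<in> tamari_complex I J" and "\<And>p. p \<in> X \<Longrightarrow> 0 \<le> g p"
      and row: "sum f {p \<in> X. fst p = i} = sum g {p \<in> X. fst p = i}"
      and col: "sum f {p \<in> X. snd p = j} = sum g {p \<in> X. snd p = j}"
      and "\<And>i' j'. (i', j') \<in> X \<Longrightarrow> j' < j \<Longrightarrow> f (i', j') = g (i', j')"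
      and "\<And>i'. (i', j) \<in> X \<Longrightarrow> i < i' \<Longrightarrow> f (i', j) = g (i', j)"
    for f g :: "nat \<times> nat \<Rightarrow> real"
  proof -
    have ijX: "(i, j) \<in> X" using ij by (simp add: D_def)
    obtain q where q: "q \<in> X" "fst q = i" "g q < f q"
      using equal_sums_compensate[OF _ row, of "(i, j)"] finX ijX lt by auto
    obtain r where r: "r \<in> X" "snd r = j" "g r < f r"
      using equal_sums_compensate[OF _ col, of "(i, j)"] finX ijX lt by auto
    obtain j' where j': "q = (i, j')" using q by (cases q) auto
    obtain i' where i': "r = (i', j)" using r by (cases r) auto
    have "j < j'"
    proof (rule ccontr)
      assume "\<not> j < j'"
      then consider "j' = j" | "j' < j" by linarith
      then show False using q that(6)[of i j'] j' that(1) by cases auto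
    qed
    moreover have "i' < i"
    proof (rule ccontr)
      assume "\<not> i' < i"
      then consider "i' = i" | "i < i'" by linarith
      then show False using r that(7)[of i'] i' that(1) by cases auto
    qed
    moreover have "f q > 0" "f r > 0" using q r that(3) by (meson le_less_trans)+
    then have "(i, j') \<in> {p \<in> X. f p \<noteq> 0}" "(i', j) \<in> {p \<in> X. f p \<noteq> 0}"
      using q r i' j' by auto
    moreover have "i < j" using ijX by (simp add: X_def arcs_between_def)
    ultimately show False using that(2) unfolding tamari_complex_iff by blast
  qed
  have mem: "i \<in> I" "j \<in> J" using ij by (auto simp: D_def X_def arcs_between_def)
  have "u (i, j) \<noteq> w (i, j)" using ij by (simp add: D_def)
  then consider "u (i, j) < w (i, j)" | "w (i, j) < u (i, j)" by linarith
  then show False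
  proof cases
    case 1
    show False
      by (rule crossing[of u w]) (use 1 supp nonneg rows cols mem jmin imax in \<open>simp_all\<close>)
  next
    case 2
    show False
      by (rule crossing[of w u]) (use 2 supp nonneg rows cols mem jmin imax in \<open>simp_all\<close>)
  qed
qed

text \<open>
  Here \<open>x\<close> is a supply at the points of \<open>I\<close>, \<open>y\<close> a demand at the points of \<open>J\<close>, and a demand can only
  be met by earlier supplies. The matching is the one that a stack produces, where the last supply in
  is the first one out: the first open demand \<open>j\<^sub>0\<close> is served by the last nonzero supply \<open>i\<^sub>0\<close> before
  it, until one of the two is used up. As no supply is left between \<open>i\<^sub>0\<close> and \<open>j\<^sub>0\<close> and no demand before
  \<open>j\<^sub>0\<close>, later arcs do not cross \<open>(i\<^sub>0, j\<^sub>0)\<close>.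
\<close>

lemma noncrossing_matching_exists:
  fixes x y :: "nat \<Rightarrow> real" and I J :: "nat set"
  defines "X \<equiv> arcs_between I J"
  assumes fin: "finite I" "finite J"
    and nonneg: "\<And>i. i \<in> I \<Longrightarrow> 0 \<le> x i" "\<And>j. j \<in> J \<Longrightarrow> 0 \<le> y j"
    and prefix: "\<And>j. j \<in> J \<Longrightarrow> sum y {j' \<in> J. j' \<le> j} \<le> sum x {i \<in> I. i < j}"
    and total: "sum x I = sum y J"
  shows "\<exists>c. (\<forall>p\<in>X. 0 \<le> c p) \<and> {p \<in> X. c p \<noteq> 0} \<in> tamari_complex I J \<and>
             (\<forall>i\<in>I. sum c {p \<in> X. fst p = i} = x i) \<and>
             (\<forall>j\<in>J. sum c {p \<in> X. snd p = j} = (y j :: real))"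
  using nonneg prefix total
proof (induction "card {i \<in> I. x i \<noteq> 0} + card {j \<in> J. y j \<noteq> 0}" arbitrary: x y rule: less_induct)
  case less
  have finX: "finite X" using fin by (simp add: X_def finite_arcs_between)
  show ?case
  proof (cases "\<exists>j\<in>J. y j \<noteq> 0")
    case False
    then have "sum x I = 0" using less.prems(4) by simp
    then have "\<forall>i\<in>I. x i = 0"
      using less.prems(1) fin(1) by (metis sum_nonneg_eq_0_iff)
    with False show ?thesis
      by (intro exI[of _ "\<lambda>p. 0"]) (auto simp: tamari_complex_iff)
  next
    case True
    define j0 where "j0 = Min {j \<in> J. y j \<noteq> 0}"
    have "j0 \<in> {j \<in> J. y j \<noteq> 0}" unfolding j0_def using fin True by (intro Min_in) auto
    then have j0: "j0 \<in> J" "y j0 > 0" using less.prems(2)[of j0] by auto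
    have before: "y j = 0" if "j \<in> J" "j < j0" for j
    proof (rule ccontr)
      assume "y j \<noteq> 0"
      then have "j0 \<le> j" unfolding j0_def using fin that by (intro Min_le) auto
      then show False using that by simp
    qed
    have "y j0 \<le> sum y {j' \<in> J. j' \<le> j0}"
      using less.prems(2) fin j0 by (intro member_le_sum) auto
    then have "sum x {i \<in> I. i < j0} > 0" using less.prems(3)[OF j0(1)] j0(2) by linarith
    then obtain i1 where i1: "i1 \<in> I" "i1 < j0" "x i1 \<noteq> 0"
      by (metis (mono_tags, lifting) less_irrefl mem_Collect_eq sum.neutral)
    define i0 where "i0 = Max {i \<in> I. i < j0 \<and> x i \<noteq> 0}"
    have "i0 \<in> {i \<in> I. i < j0 \<and> x i \<noteq> 0}" unfolding i0_def using fin i1 by (intro Max_in) auto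
    then have i0: "i0 \<in> I" "i0 < j0" "x i0 > 0" using less.prems(1)[of i0] by auto
    have between: "x i = 0" if "i \<in> I" "i0 < i" "i < j0" for i
    proof (rule ccontr)
      assume "x i \<noteq> 0"
      then have "i \<le> i0" unfolding i0_def using fin that by (intro Max_ge) auto
      then show False using that by simp
    qed
    define t where "t = min (x i0) (y j0)"
    have t: "t > 0" "t \<le> x i0" "t \<le> y j0" "t = x i0 \<or> t = y j0" using i0 j0 by (auto simp: t_def)
    define x' where "x' = x(i0 := x i0 - t)"
    define y' where "y' = y(j0 := y j0 - t)"
    have x'sum: "sum x' S = sum x S - (if i0 \<in> S then t else 0)" if "finite S" for S
      using sum_fun_upd_add[OF that, of x i0 "- t"] by (simp add: x'_def)
    have y'sum: "sum y' S = sum y S - (if j0 \<in> S then t else 0)" if "finite S" for S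
      using sum_fun_upd_add[OF that, of y j0 "- t"] by (simp add: y'_def)
    have sub: "{i \<in> I. x' i \<noteq> 0} \<subseteq> {i \<in> I. x i \<noteq> 0}" "{j \<in> J. y' j \<noteq> 0} \<subseteq> {j \<in> J. y j \<noteq> 0}"
      using i0 j0 by (auto simp: x'_def y'_def)
    have "card {i \<in> I. x' i \<noteq> 0} \<le> card {i \<in> I. x i \<noteq> 0}"
      "card {j \<in> J. y' j \<noteq> 0} \<le> card {j \<in> J. y j \<noteq> 0}"
      using sub fin by (auto intro!: card_mono)
    moreover have "card {i \<in> I. x' i \<noteq> 0} < card {i \<in> I. x i \<noteq> 0} \<or>
      card {j \<in> J. y' j \<noteq> 0} < card {j \<in> J. y j \<noteq> 0}"
    proof (cases "t = x i0")
      case True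
      then have "i0 \<in> {i \<in> I. x i \<noteq> 0} - {i \<in> I. x' i \<noteq> 0}" using i0 by (simp add: x'_def)
      then have "{i \<in> I. x' i \<noteq> 0} \<subset> {i \<in> I. x i \<noteq> 0}" using sub by blast
      then show ?thesis using fin by (simp add: psubset_card_mono)
    next
      case False
      then have "j0 \<in> {j \<in> J. y j \<noteq> 0} - {j \<in> J. y' j \<noteq> 0}" using j0 t by (simp add: y'_def)
      then have "{j \<in> J. y' j \<noteq> 0} \<subset> {j \<in> J. y j \<noteq> 0}" using sub by blast
      then show ?thesis using fin by (simp add: psubset_card_mono)
    qed
    ultimately have smaller: "card {i \<in> I. x' i \<noteq> 0} + card {j \<in> J. y' j \<noteq> 0} <
      card {i \<in> I. x i \<noteq> 0} + card {j \<in> J. y j \<noteq> 0}" by linarith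
    have x'0: "0 \<le> x' i" if "i \<in> I" for i using that less.prems(1) t by (simp add: x'_def)
    have y'0: "0 \<le> y' j" if "j \<in> J" for j using that less.prems(2) t by (simp add: y'_def)
    have "sum y' {j' \<in> J. j' \<le> j} \<le> sum x' {i \<in> I. i < j}" if j: "j \<in> J" for j
    proof (cases "j < j0")
      case True
      then have "sum y' {j' \<in> J. j' \<le> j} = 0" using before by (intro sum.neutral) (auto simp: y'_def)
      moreover have "sum x' {i \<in> I. i < j} \<ge> 0" using x'0 by (intro sum_nonneg) auto
      ultimately show ?thesis by simp
    next
      case False
      then show ?thesis using less.prems(3)[OF j] x'sum y'sum fin i0 j0 by simp
    qed
    moreover have "sum x' I = sum y' J" using less.prems(4) x'sum y'sum fin i0 j0 by simp
    ultimately obtain c where c: "\<forall>p\<in>X. 0 \<le> c p" "{p \<in> X. c p \<noteq> 0} \<in> tamari_complex I J"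
      "\<forall>i\<in>I. sum c {p \<in> X. fst p = i} = x' i" "\<forall>j\<in>J. sum c {p \<in> X. snd p = j} = y' j"
      using less.hyps[OF smaller x'0 y'0] by blast
    define c' where "c' = c((i0, j0) := c (i0, j0) + t)"
    have c'sum: "sum c' S = sum c S + (if (i0, j0) \<in> S then t else 0)" if "finite S" for S
      using sum_fun_upd_add[OF that] by (simp add: c'_def)
    have ijX: "(i0, j0) \<in> X" using i0 j0 by (simp add: X_def arcs_between_def)
    have pos: "x i \<noteq> 0" "y j \<noteq> 0" if "(i, j) \<in> X" "c (i, j) \<noteq> 0" for i j
    proof -
      have ij: "i \<in> I" "j \<in> J" using that by (auto simp: X_def arcs_between_def)
      have "c (i, j) > 0" using that c(1) by force
      moreover have "c (i, j) \<le> sum c {p \<in> X. fst p = i}" "c (i, j) \<le> sum c {p \<in> X. snd p = j}"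
        using that c(1) finX by (auto intro!: member_le_sum)
      ultimately have "x' i > 0" "y' j > 0" using c(3,4) ij by force+
      then show "x i \<noteq> 0" "y j \<noteq> 0" using i0 j0 by (auto simp: x'_def y'_def split: if_splits)
    qed
    have nc: False if "(i, j) \<in> X" "c (i, j) \<noteq> 0" "(i', j') \<in> X" "c (i', j') \<noteq> 0"
      "i < i'" "i' < j" "j < j'" for i j i' j'
      using c(2) that unfolding tamari_complex_iff by blast
    have "{p \<in> X. c' p \<noteq> 0} \<in> tamari_complex I J"
      unfolding tamari_complex_iff
    proof (intro conjI allI impI)
      show "{p \<in> X. c' p \<noteq> 0} \<subseteq> arcs_between I J" by (auto simp: X_def)
      fix i j i' j'
      assume a: "(i, j) \<in> {p \<in> X. c' p \<noteq> 0}" "(i', j') \<in> {p \<in> X. c' p \<noteq> 0}"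
        "i < i'" "i' < j" "j < j'"
      have IJ: "j \<in> J" "i' \<in> I" using a by (auto simp: X_def arcs_between_def)
      consider "(i, j) = (i0, j0)" | "(i', j') = (i0, j0)" | "c (i, j) \<noteq> 0" "c (i', j') \<noteq> 0"
        using a by (auto simp: c'_def split: if_splits)
      then show False
      proof cases
        case 1
        then have "c (i', j') \<noteq> 0" "(i', j') \<in> X" using a by (auto simp: c'_def)
        then show False using pos(1) between[of i'] IJ a 1 by auto
      next
        case 2
        then have "c (i, j) \<noteq> 0" "(i, j) \<in> X" using a by (auto simp: c'_def)
        then show False using pos(2) before[of j] IJ a 2 by auto
      next
        case 3
        then show False using nc a by blast
      qed
    qed
    moreover have "\<forall>p\<in>X. 0 \<le> c' p" using c(1) t by (simp add: c'_def)
    moreover have "sum c' {p \<in> X. fst p = i} = x i" if "i \<in> I" for i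
      using that c(3) c'sum finX ijX by (simp add: x'_def)
    moreover have "sum c' {p \<in> X. snd p = j} = y j" if "j \<in> J" for j
      using that c(4) c'sum finX ijX by (simp add: y'_def)
    ultimately show ?thesis by blast
  qed
qed

section \<open>Simplicial complexes from unique barycentric coordinates\<close>

text \<open>
  A placement of the vertices of an abstract complex such that a point is a convex combination of
  vertices supported on a face in at most one way. The two weightings compared in \<open>weights_unique\<close>
  may be supported on different faces. With a common face the condition says that faces become
  simplices, with different faces it says that these simplices meet in common faces.
\<close>

locale barycentric_placement =
  fixes K :: "'v set set" and V :: "'v \<Rightarrow> 'n::euclidean_space"
  assumes finite_vertices: "finite (\<Union>K)"
    and subface: "A \<in> K \<Longrightarrow> B \<subseteq> A \<Longrightarrow> B \<in> K"
    and weights_unique: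
      "\<lbrakk>\<And>v. v \<in> \<Union>K \<Longrightarrow> 0 \<le> u v; \<And>v. v \<in> \<Union>K \<Longrightarrow> 0 \<le> w v;
        {v \<in> \<Union>K. u v \<noteq> 0} \<in> K; {v \<in> \<Union>K. w v \<noteq> 0} \<in> K;
        sum u (\<Union>K) = 1; sum w (\<Union>K) = 1;
        (\<Sum>v\<in>\<Union>K. u v *\<^sub>R V v) = (\<Sum>v\<in>\<Union>K. w v *\<^sub>R V v); v \<in> \<Union>K\<rbrakk> \<Longrightarrow> u v = w v"
begin

lemma finite_face: "A \<in> K \<Longrightarrow> finite A"
  using finite_vertices by (meson Union_upper finite_subset)

lemma finite_complex: "finite K"
  using finite_vertices by (rule finite_UnionD)

lemma inj_placement: "inj_on V (\<Union>K)"
proof (rule inj_onI, rule ccontr)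
  fix p q assume pq: "p \<in> \<Union>K" "q \<in> \<Union>K" "V p = V q" "p \<noteq> q"
  define \<delta> where "\<delta> = (\<lambda>r v :: 'v. if v = r then 1 else 0 :: real)"
  have \<delta>: "{v \<in> \<Union>K. \<delta> r v \<noteq> 0} \<in> K" "sum (\<delta> r) (\<Union>K) = 1"
    "(\<Sum>v\<in>\<Union>K. \<delta> r v *\<^sub>R V v) = V r" if r: "r \<in> \<Union>K" for r
  proof -
    have "{v \<in> \<Union>K. \<delta> r v \<noteq> 0} = {r}" using r by (auto simp: \<delta>_def)
    moreover have "{r} \<in> K" using r subface by blast
    ultimately show "{v \<in> \<Union>K. \<delta> r v \<noteq> 0} \<in> K" by simp
    show "sum (\<delta> r) (\<Union>K) = 1" using r finite_vertices by (simp add: \<delta>_def)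
    have "(\<Sum>v\<in>\<Union>K. \<delta> r v *\<^sub>R V v) = (\<Sum>v\<in>\<Union>K. if v = r then V v else 0)"
      by (rule sum.cong) (auto simp: \<delta>_def)
    then show "(\<Sum>v\<in>\<Union>K. \<delta> r v *\<^sub>R V v) = V r" using r finite_vertices by simp
  qed
  have "\<delta> p p = \<delta> q p"
    by (rule weights_unique) (use \<delta> pq in \<open>simp_all add: \<delta>_def\<close>)
  then show False using pq by (simp add: \<delta>_def)
qed

lemma inj_face: "A \<in> K \<Longrightarrow> inj_on V A"
  using inj_placement by (rule inj_on_subset) auto

lemma sum_face:
  assumes "A \<in> K" and "\<And>v. v \<notin> A \<Longrightarrow> f v = 0"
  shows "sum f (\<Union>K) = sum f A"
  by (rule sum.mono_neutral_right) (use assms finite_vertices in auto)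

lemma face_hull_weights:
  assumes A: "A \<in> K" and x: "x \<in> convex hull (V ` A)"
  obtains u where "\<And>v. 0 \<le> u v" "\<And>v. v \<notin> A \<Longrightarrow> u v = 0" "sum u (\<Union>K) = 1"
    "x = (\<Sum>v\<in>\<Union>K. u v *\<^sub>R V v)"
proof -
  obtain c where c: "\<forall>y\<in>V ` A. 0 \<le> c y" "sum c (V ` A) = 1" "(\<Sum>y\<in>V ` A. c y *\<^sub>R y) = x"
    using x convex_hull_finite[of "V ` A"] finite_face[OF A] by auto
  define u where "u v = (if v \<in> A then c (V v) else 0)" for v
  show thesis
  proof
    show "0 \<le> u v" for v using c(1) by (simp add: u_def)
    show u0: "u v = 0" if "v \<notin> A" for v using that by (simp add: u_def)
    have "sum u A = sum c (V ` A)" by (simp add: sum.reindex[OF inj_face[OF A]] u_def)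
    then show "sum u (\<Union>K) = 1" using c(2) sum_face[OF A, of u] u0 by simp
    have "(\<Sum>v\<in>A. u v *\<^sub>R V v) = (\<Sum>y\<in>V ` A. c y *\<^sub>R y)"
      by (simp add: sum.reindex[OF inj_face[OF A]] u_def)
    then show "x = (\<Sum>v\<in>\<Union>K. u v *\<^sub>R V v)"
      using c(3) sum_face[OF A, of "\<lambda>v. u v *\<^sub>R V v"] u0 by simp
  qed
qed

lemma weights_in_face_hull:
  assumes A: "A \<in> K" and u: "\<And>v. v \<in> A \<Longrightarrow> 0 \<le> u v" "\<And>v. v \<in> \<Union>K \<Longrightarrow> v \<notin> A \<Longrightarrow> u v = 0"
    and "sum u (\<Union>K) = 1"
  shows "(\<Sum>v\<in>\<Union>K. u v *\<^sub>R V v) \<in> convex hull (V ` A)"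
proof -
  have "sum u (\<Union>K) = sum u A" "(\<Sum>v\<in>\<Union>K. u v *\<^sub>R V v) = (\<Sum>v\<in>A. u v *\<^sub>R V v)"
    by (rule sum.mono_neutral_right; use A u finite_vertices in auto)+
  then show ?thesis
    using assms finite_face[OF A] by (simp add: convex_sum convex_convex_hull hull_inc)
qed

text \<open>
  A point of both hulls has two weightings, supported in \<open>A\<close> and in \<open>B\<close>; they agree, so their common
  support lies in \<open>A \<inter> B\<close>.
\<close>

lemma hull_inter:
  assumes "A \<in> K" and "B \<in> K"
  shows "convex hull (V ` A) \<inter> convex hull (V ` B) = convex hull (V ` (A \<inter> B))"
proof
  show "convex hull (V ` A) \<inter> convex hull (V ` B) \<subseteq> convex hull (V ` (A \<inter> B))"
  proof
    fix x assume x: "x \<in> convex hull (V ` A) \<inter> convex hull (V ` B)"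
    then obtain u where u: "\<And>v. 0 \<le> u v" "\<And>v. v \<notin> A \<Longrightarrow> u v = 0" "sum u (\<Union>K) = 1"
      "x = (\<Sum>v\<in>\<Union>K. u v *\<^sub>R V v)" using face_hull_weights[OF assms(1)] by blast
    from x obtain w where w: "\<And>v. 0 \<le> w v" "\<And>v. v \<notin> B \<Longrightarrow> w v = 0" "sum w (\<Union>K) = 1"
      "x = (\<Sum>v\<in>\<Union>K. w v *\<^sub>R V v)" using face_hull_weights[OF assms(2)] by blast
    have supp: "{v \<in> \<Union>K. u v \<noteq> 0} \<in> K" "{v \<in> \<Union>K. w v \<noteq> 0} \<in> K"
      using u(2) w(2) by (auto intro: subface[OF assms(1)] subface[OF assms(2)])
    have eq: "u v = w v" if "v \<in> \<Union>K" for v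
      by (rule weights_unique) (use u w supp that in auto)
    then have "u v = 0" if "v \<in> \<Union>K" "v \<notin> A \<inter> B" for v
      using that(2) u(2)[of v] w(2)[of v] eq[OF that(1)] by auto
    then show "x \<in> convex hull (V ` (A \<inter> B))"
      unfolding u(4) using u(1,3) subface[OF assms(1), of "A \<inter> B"]
      by (intro weights_in_face_hull) auto
  qed
  show "convex hull (V ` (A \<inter> B)) \<subseteq> convex hull (V ` A) \<inter> convex hull (V ` B)"
    by (intro Int_greatest hull_mono) auto
qed

text \<open>
  In an affine dependence the coefficients sum to \<open>0\<close>, so its positive and its negative part have the
  same total \<open>s\<close>. Divided by \<open>s\<close> they are two different weightings, within one face, of one point.
\<close>

lemma face_independent:
  assumes A: "A \<in> K"
  shows "\<not> affine_dependent (V ` A)"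
proof
  assume "affine_dependent (V ` A)"
  then obtain U where U: "sum U (V ` A) = 0" "\<exists>y\<in>V ` A. U y \<noteq> 0" "(\<Sum>y\<in>V ` A. U y *\<^sub>R y) = 0"
    using affine_dependent_explicit_finite[of "V ` A"] finite_face[OF A] by auto
  define c where "c v = (if v \<in> A then U (V v) else 0)" for v
  have c0: "c v = 0" if "v \<notin> A" for v using that by (simp add: c_def)
  have "sum c A = 0" "(\<Sum>v\<in>A. c v *\<^sub>R V v) = 0"
    using U(1,3) by (simp_all add: sum.reindex[OF inj_face[OF A]] c_def)
  then have csum: "sum c (\<Union>K) = 0" "(\<Sum>v\<in>\<Union>K. c v *\<^sub>R V v) = 0"
    using sum_face[OF A, of c] sum_face[OF A, of "\<lambda>v. c v *\<^sub>R V v"] c0 by simp_all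
  obtain v0 where v0: "v0 \<in> A" "c v0 \<noteq> 0" using U(2) by (auto simp: c_def)
  define s where "s = (\<Sum>v\<in>\<Union>K. max (c v) 0)"
  have neg: "(\<Sum>v\<in>\<Union>K. max (- c v) 0) = s"
  proof -
    have "max (- c v) 0 = max (c v) 0 - c v" for v by (simp add: max_def)
    then show ?thesis using csum(1) by (simp add: sum_subtractf s_def)
  qed
  have "s > 0"
  proof -
    have v0K: "v0 \<in> \<Union>K" using v0(1) A by blast
    have "max (c v0) 0 \<le> s" "max (- c v0) 0 \<le> (\<Sum>v\<in>\<Union>K. max (- c v) 0)"
      unfolding s_def by (intro member_le_sum v0K finite_vertices; simp)+
    then show ?thesis using neg v0(2) by linarith
  qed
  have supp: "{v \<in> \<Union>K. max (c v) 0 / s \<noteq> 0} \<in> K" "{v \<in> \<Union>K. max (- c v) 0 / s \<noteq> 0} \<in> K"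
    by (auto intro!: subface[OF A] simp: c_def)
  have "max (c v0) 0 / s = max (- c v0) 0 / s"
  proof (rule weights_unique)
    have "(\<Sum>v\<in>\<Union>K. (max (c v) 0 / s) *\<^sub>R V v) - (\<Sum>v\<in>\<Union>K. (max (- c v) 0 / s) *\<^sub>R V v)
      = (\<Sum>v\<in>\<Union>K. (1 / s) *\<^sub>R c v *\<^sub>R V v)"
      unfolding sum_subtractf[symmetric] scaleR_left_diff_distrib[symmetric]
      by (rule sum.cong) (auto simp: max_def)
    also have "\<dots> = (1 / s) *\<^sub>R (\<Sum>v\<in>\<Union>K. c v *\<^sub>R V v)"
      by (rule scaleR_sum_right[symmetric])
    finally show "(\<Sum>v\<in>\<Union>K. (max (c v) 0 / s) *\<^sub>R V v) = (\<Sum>v\<in>\<Union>K. (max (- c v) 0 / s) *\<^sub>R V v)"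
      using csum(2) by simp
    show "(\<Sum>v\<in>\<Union>K. max (c v) 0 / s) = 1" "(\<Sum>v\<in>\<Union>K. max (- c v) 0 / s) = 1"
      using \<open>s > 0\<close> neg unfolding sum_divide_distrib[symmetric] s_def[symmetric] by simp_all
    show "v0 \<in> \<Union>K" using v0(1) A by blast
  qed (use supp \<open>s > 0\<close> in simp_all)
  then show False using \<open>s > 0\<close> v0(2) by (auto simp: max_def split: if_splits)
qed

lemma face_simplex:
  assumes "A \<in> K"
  shows "(int (card A) - 1) simplex (convex hull (V ` A))"
  unfolding simplex_def
  using face_independent[OF assms] card_image[OF inj_face[OF assms]]
  by (intro exI[of _ "V ` A"]) simp

lemma face_of_hull_iff:
  assumes "A \<in> K"
  shows "S face_of (convex hull (V ` A)) \<longleftrightarrow> (\<exists>B\<subseteq>A. S = convex hull (V ` B))"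
  unfolding face_of_convex_hull_affine_independent[OF face_independent[OF assms]]
  by (auto simp: subset_image_iff)

theorem hulls_realize:
  "geometric_realization ((\<lambda>A. convex hull (V ` A)) ` K) K"
proof -
  let ?T = "(\<lambda>A. convex hull (V ` A)) ` K"
  have "simplicial_complex ?T"
    unfolding simplicial_complex_def
  proof (intro conjI ballI allI impI)
    show "finite ?T" using finite_complex by simp
    show "\<exists>n. n simplex S" if "S \<in> ?T" for S using that face_simplex by blast
    show "F \<in> ?T" if "S \<in> ?T \<and> F face_of S" for F S
      using that face_of_hull_iff subface by blast
    show "(S \<inter> S') face_of S" if SS: "S \<in> ?T \<and> S' \<in> ?T" for S S'
    proof -
      obtain A B where AB: "A \<in> K" "B \<in> K" "S = convex hull (V ` A)" "S' = convex hull (V ` B)"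
        using SS by blast
      then show ?thesis using hull_inter[OF AB(1,2)] face_of_hull_iff[OF AB(1)] by auto
    qed
  qed
  moreover have "complex_isomorphic (vertex_scheme ?T) K"
  proof -
    have vs: "vertex_scheme ?T = (`) V ` K"
      unfolding vertex_scheme_def image_image
      by (rule image_cong)
        (auto simp: extreme_point_of_convex_hull_affine_independent[OF face_independent])
    have U: "\<Union>((`) V ` K) = V ` \<Union>K" by auto
    let ?\<phi> = "inv_into (\<Union>K) V"
    have "bij_betw ?\<phi> (V ` \<Union>K) (\<Union>K)"
      using inj_placement by (simp add: bij_betw_inv_into inj_on_imp_bij_betw)
    moreover have "S \<in> (`) V ` K \<longleftrightarrow> ?\<phi> ` S \<in> K" if "S \<subseteq> V ` \<Union>K" for S
    proof -
      obtain B where B: "B \<subseteq> \<Union>K" "S = V ` B" using \<open>S \<subseteq> V ` \<Union>K\<close> by (auto simp: subset_image_iff)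
      have "?\<phi> ` S = B" using B inj_placement by (simp add: inv_into_image_cancel)
      moreover have "S \<in> (`) V ` K \<longleftrightarrow> B \<in> K"
      proof
        assume "S \<in> (`) V ` K"
        then obtain A where "A \<in> K" "V ` B = V ` A" using B(2) by blast
        then show "B \<in> K" using inj_placement B(1)
          by (metis Union_upper inj_on_image_eq_iff)
      qed (use B in blast)
      ultimately show ?thesis by simp
    qed
    ultimately show ?thesis unfolding complex_isomorphic_def vs U by blast
  qed
  ultimately show ?thesis by (simp add: geometric_realization_def)
qed

end

text \<open>
  Uniqueness of weights survives a linear map that is injective on a subspace with all the vertices.
\<close>

lemma barycentric_placement_linear_image:
  assumes "barycentric_placement K V" and "linear f" and inj: "inj_on f S" and S: "subspace S"
    and VS: "V ` \<Union>K \<subseteq> S"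
  shows "barycentric_placement K (f \<circ> V)"
proof -
  interpret barycentric_placement K V by fact
  show ?thesis
  proof
    show "finite (\<Union>K)" by (rule finite_vertices)
    show "B \<in> K" if "A \<in> K" "B \<subseteq> A" for A B using that by (rule subface)
    fix u w p
    assume *: "\<And>v. v \<in> \<Union>K \<Longrightarrow> 0 \<le> u v" "\<And>v. v \<in> \<Union>K \<Longrightarrow> 0 \<le> w v"
      "{v \<in> \<Union>K. u v \<noteq> 0} \<in> K" "{v \<in> \<Union>K. w v \<noteq> 0} \<in> K"
      "sum u (\<Union>K) = 1" "sum w (\<Union>K) = 1"
      and eq: "(\<Sum>v\<in>\<Union>K. u v *\<^sub>R (f \<circ> V) v) = (\<Sum>v\<in>\<Union>K. w v *\<^sub>R (f \<circ> V) v)" and p: "p \<in> \<Union>K"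
    have lin: "(\<Sum>v\<in>\<Union>K. r v *\<^sub>R (f \<circ> V) v) = f (\<Sum>v\<in>\<Union>K. r v *\<^sub>R V v)" for r
      using \<open>linear f\<close> by (simp add: linear_sum linear_scale)
    have "(\<Sum>v\<in>\<Union>K. r v *\<^sub>R V v) \<in> S" for r
      using VS by (intro subspace_sum[OF S] subspace_scale[OF S]) auto
    then have "(\<Sum>v\<in>\<Union>K. u v *\<^sub>R V v) = (\<Sum>v\<in>\<Union>K. w v *\<^sub>R V v)"
      using eq inj unfolding lin by (auto dest: inj_onD)
    then show "u p = w p" using weights_unique * p by blast
  qed
qed

section \<open>Comparing paths at their first difference\<close>

lemma first_difference_unique:
  assumes "S @ e # P = S' @ e' # P'" and "S @ f # Q = S' @ f' # Q'" and "e \<noteq> f" and "e' \<noteq> f'"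
  shows "S = S' \<and> e = e' \<and> f = f'"
  using assms
proof (induction S arbitrary: S')
  case Nil
  then show ?case by (cases S') auto
next
  case (Cons a S)
  then show ?case by (cases S') auto
qed

lemma prec_in_iff:
  assumes P: "P = P' @ e # S" and Q: "Q = Q' @ f # S" and "e \<noteq> f"
  shows "prec_in G fin P Q \<longleftrightarrow> (e, f) \<in> fin (head G e)"
proof
  assume "prec_in G fin P Q"
  then obtain P1 Q1 e1 f1 S1 where *: "P = P1 @ e1 # S1" "Q = Q1 @ f1 # S1" "e1 \<noteq> f1"
    "(e1, f1) \<in> fin (head G e1)" unfolding prec_in_def by blast
  have "rev S @ e # rev P' = rev S1 @ e1 # rev P1" "rev S @ f # rev Q' = rev S1 @ f1 # rev Q1"
    using arg_cong[OF *(1), of rev] arg_cong[OF *(2), of rev] assms by simp_all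
  from first_difference_unique[OF this assms(3) *(3)]
  show "(e, f) \<in> fin (head G e)" using *(4) by simp
next
  assume "(e, f) \<in> fin (head G e)"
  then show "prec_in G fin P Q" unfolding prec_in_def using assms by blast
qed

lemma prec_out_iff:
  assumes P: "P = S @ e # P'" and Q: "Q = S @ f # Q'" and "e \<noteq> f"
  shows "prec_out G fout P Q \<longleftrightarrow> (e, f) \<in> fout (tail G e)"
proof
  assume "prec_out G fout P Q"
  then obtain P1 Q1 e1 f1 S1 where *: "P = S1 @ e1 # P1" "Q = S1 @ f1 # Q1" "e1 \<noteq> f1"
    "(e1, f1) \<in> fout (tail G e1)" unfolding prec_out_def by blast
  from first_difference_unique[OF *(1)[unfolded P] *(2)[unfolded Q] assms(3) *(3)]
  show "(e, f) \<in> fout (tail G e)" using *(4) by simp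
next
  assume "(e, f) \<in> fout (tail G e)"
  then show "prec_out G fout P Q" unfolding prec_out_def using assms by blast
qed

lemma not_prec_refl: "\<not> prec_in G fin P P" "\<not> prec_out G fout P P"
  unfolding prec_in_def prec_out_def by auto

section \<open>Positions of the steps of a lattice path\<close>

text \<open>
  For \<open>2 \<le> v \<le> a + 2\<close> this is the position in \<open>E \<nu> N\<close> of the \<open>(v - 1)\<close>-st north step, which stands for
  leaving the inner vertex \<open>v\<close> of the caracol graph towards the sink. The east steps right
  before this north step will stand for the edges from \<open>1\<close> to \<open>v\<close>.
\<close>

definition level :: "nat list \<Rightarrow> nat \<Rightarrow> nat" where
  "level \<nu> v = v + sum_list (take (v - 2) \<nu>)"

lemma level_Suc:
  assumes "2 \<le> v" and "v \<le> length \<nu> + 1"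
  shows "level \<nu> (Suc v) = Suc (level \<nu> v) + \<nu> ! (v - 2)"
proof -
  have "take (Suc v - 2) \<nu> = take (v - 2) \<nu> @ [\<nu> ! (v - 2)]"
    using assms take_Suc_conv_app_nth[of "v - 2" \<nu>] Suc_diff_le[of 2 v] by simp
  then show ?thesis by (simp add: level_def)
qed

lemma level_pred:
  assumes "3 \<le> v" and "v \<le> length \<nu> + 2"
  shows "level \<nu> v = Suc (level \<nu> (v - 1)) + \<nu> ! (v - 3)"
proof -
  obtain u where u: "v = Suc u" "2 \<le> u" using assms(1) by (cases v) auto
  then show ?thesis using level_Suc[of u \<nu>] assms(2) by (simp add: numeral_3_eq_3 numeral_2_eq_2)
qed

lemma strict_mono_level: "strict_mono (level \<nu>)"
proof (rule strict_monoI_Suc)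
  fix v
  have "sum_list (take (v - 2) \<nu>) \<le> sum_list (take (Suc v - 2) \<nu>)"
  proof -
    have "take (Suc v - 2) \<nu> = take (v - 2) \<nu> @ take (Suc v - 2 - (v - 2)) (drop (v - 2) \<nu>)"
      by (metis diff_le_mono le_add_diff_inverse le_SucI order_refl take_add)
    then show ?thesis by simp
  qed
  then show "level \<nu> v < level \<nu> (Suc v)" by (simp add: level_def)
qed

lemma length_lattice_path: "length (lattice_path \<nu>) = length \<nu> + sum_list \<nu>"
  by (induction \<nu>) (auto simp: lattice_path_def)

lemma North_positions_lattice_path:
  "step_positions North (lattice_path \<nu>) = (\<lambda>i. Suc (i + sum_list (take i \<nu>))) ` {..<length \<nu>}"
proof (induction \<nu> rule: rev_induct)
  case Nil
  then show ?case by (auto simp: step_positions_def lattice_path_def)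
next
  case (snoc m \<nu>)
  have "p \<in> step_positions North (w @ North # replicate m East) \<longleftrightarrow>
    p \<in> step_positions North w \<or> p = Suc (length w)" for p w
    unfolding step_positions_def
    by (auto simp: nth_append nth_Cons split: if_splits nat.splits)
  then have "step_positions North (w @ North # replicate m East) =
    insert (Suc (length w)) (step_positions North w)" for w by blast
  moreover have "lattice_path (\<nu> @ [m]) = lattice_path \<nu> @ North # replicate m East"
    by (simp add: lattice_path_def)
  ultimately show ?case
    using snoc by (simp add: length_lattice_path lessThan_Suc)
qed

lemma length_extended_path: "length (extended_path \<nu>) = length \<nu> + sum_list \<nu> + 2"
  by (simp add: extended_path_def length_lattice_path)

lemma path_J_eq: "path_J \<nu> = level \<nu> ` {2..length \<nu> + 2}"
proof -
  have "p \<in> step_positions North (East # w @ [North]) \<longleftrightarrow>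
    p \<in> Suc ` step_positions North w \<or> p = length w + 2" for p w
  proof (cases p)
    case (Suc q)
    then show ?thesis
      by (cases q) (auto simp: step_positions_def nth_append nth_Cons inj_image_mem_iff
          split: if_splits nat.splits)
  qed (auto simp: step_positions_def)
  then have "path_J \<nu> = insert (length (lattice_path \<nu>) + 2) (Suc ` step_positions North (lattice_path \<nu>))"
    unfolding path_J_def extended_path_def by blast
  also have "\<dots> = insert (level \<nu> (length \<nu> + 2)) ((\<lambda>i. level \<nu> (i + 2)) ` {..<length \<nu>})"
    by (simp add: North_positions_lattice_path image_image length_lattice_path level_def)
  also have "\<dots> = (\<lambda>i. level \<nu> (i + 2)) ` {..length \<nu>}"
    by (auto simp: lessThan_Suc_atMost[symmetric] lessThan_Suc)
  also have "\<dots> = level \<nu> ` (\<lambda>i. i + 2) ` {0..length \<nu>}"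
    by (simp add: image_image atMost_atLeast0)
  also have "(\<lambda>i. i + 2) ` {0..length \<nu>} = {2..length \<nu> + 2}"
    using image_add_atLeastAtMost'[of 2 0 "length \<nu>"] by simp
  finally show ?thesis .
qed

lemma path_I_eq: "path_I \<nu> = {1..length \<nu> + sum_list \<nu> + 2} - path_J \<nu>"
proof -
  have "p \<in> path_I \<nu> \<longleftrightarrow> p \<in> {1..length \<nu> + sum_list \<nu> + 2} - path_J \<nu>" for p
    by (cases "extended_path \<nu> ! (p - 1)")
      (simp_all add: path_I_def path_J_def step_positions_def length_extended_path)
  then show ?thesis by blast
qed

lemma card_path_J: "card (path_J \<nu>) = length \<nu> + 1"
  unfolding path_J_eq using strict_mono_level
  by (simp add: card_image strict_mono_imp_inj_on inj_on_subset)

lemma path_J_subset: "path_J \<nu> \<subseteq> {1..length \<nu> + sum_list \<nu> + 2}"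
  unfolding path_J_def step_positions_def by (auto simp: length_extended_path)

lemma card_path_I: "card (path_I \<nu>) = sum_list \<nu> + 1"
  unfolding path_I_eq using path_J_subset[of \<nu>]
  by (subst card_Diff_subset) (auto simp: card_path_J intro: finite_subset)

lemma finite_paths: "finite (path_I \<nu>)" "finite (path_J \<nu>)"
  using path_J_subset[of \<nu>] by (auto simp: path_I_eq intro: finite_subset)

lemma level_2: "level \<nu> 2 = 2"
  by (simp add: level_def)

lemma path_I_iff:
  "p \<in> path_I \<nu> \<longleftrightarrow> 1 \<le> p \<and> p < level \<nu> (length \<nu> + 2) \<and>
     (\<forall>v\<in>{2..length \<nu> + 2}. p \<noteq> level \<nu> v)"
proof -
  have last: "length \<nu> + sum_list \<nu> + 2 = level \<nu> (length \<nu> + 2)" by (simp add: level_def)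
  have "p \<in> {1..f n} - f ` {2..n} \<longleftrightarrow> 1 \<le> p \<and> p < f n \<and> (\<forall>v\<in>{2..n}. p \<noteq> f v)"
    if "2 \<le> n" for f and n :: nat
    using that by (auto simp: less_le)
  then show ?thesis unfolding path_I_eq path_J_eq last by simp
qed

section \<open>The edges of the caracol graph\<close>

locale caracol =
  fixes \<nu> :: "nat list" and G :: "(nat, 'e::finite) pre_digraph" and lab :: "'e \<Rightarrow> nat"
  assumes caracol: "is_caracol \<nu> G lab"
begin

abbreviation "a \<equiv> length \<nu>"

lemma arcs_UNIV: "arcs G = UNIV"
  using caracol by (auto simp: is_caracol_def)

lemma edge_in: "(tail G e, head G e, lab e) \<in> caracol_edges \<nu>"
  using caracol unfolding is_caracol_def bij_betw_def by blast

lemma edge_eqI: "tail G e = tail G f \<Longrightarrow> head G e = head G f \<Longrightarrow> lab e = lab f \<Longrightarrow> e = f"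
  using caracol unfolding is_caracol_def bij_betw_def inj_def by simp

lemma edge_ex:
  assumes "(i, j, m) \<in> caracol_edges \<nu>"
  obtains e where "tail G e = i" "head G e = j" "lab e = m"
proof -
  have "(i, j, m) \<in> range (\<lambda>e. (tail G e, head G e, lab e))"
    using caracol assms unfolding is_caracol_def bij_betw_def by simp
  then show thesis using that by auto
qed

lemma edge_cases:
  obtains (first) "tail G e = 1" "head G e = 2" "lab e = 1"
  | (jump) "tail G e = 1" "3 \<le> head G e" "head G e \<le> a + 2" "1 \<le> lab e" "lab e \<le> \<nu> ! (head G e - 3)"
  | (exit) "2 \<le> tail G e" "tail G e \<le> a + 2" "head G e = a + 3" "lab e = 1"
  | (link) "2 \<le> tail G e" "tail G e \<le> a + 1" "head G e = Suc (tail G e)" "lab e = 1"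
proof -
  from edge_in[of e] consider
    (A) i m where "tail G e = 1" "head G e = i + 2" "lab e = m" "1 \<le> i" "i \<le> a" "1 \<le> m" "m \<le> \<nu> ! (i - 1)"
    | (B) i where "tail G e = i" "head G e = a + 3" "lab e = 1" "2 \<le> i" "i \<le> a + 1"
    | (C) i where "tail G e = i" "head G e = i + 1" "lab e = 1" "1 \<le> i" "i \<le> a + 2"
    unfolding caracol_edges_def Let_def by blast
  then show thesis
  proof cases
    case A then show ?thesis by (intro jump) (auto simp: numeral_3_eq_3)
  next
    case B then show ?thesis by (intro exit) auto
  next
    case C
    then consider "i = 1" | "i = a + 2" | "2 \<le> i" "i \<le> a + 1" by linarith
    then show ?thesis using C by cases (auto intro: first exit link)
  qed
qed

definition sources :: "'e set" where
  "sources = {e. tail G e = 1}"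

definition exit_edge :: "nat \<Rightarrow> 'e" where
  "exit_edge v = (SOME e. tail G e = v \<and> head G e = a + 3)"

definition link_edge :: "nat \<Rightarrow> 'e" where
  "link_edge v = (SOME e. tail G e = v \<and> head G e = Suc v)"

lemma exit_edge:
  assumes "2 \<le> v" and "v \<le> a + 2"
  shows "tail G (exit_edge v) = v" "head G (exit_edge v) = a + 3"
proof -
  have "(v, a + 3, 1) \<in> caracol_edges \<nu>"
    using assms unfolding caracol_edges_def Let_def by (cases "v = a + 2") auto
  then obtain e where "tail G e = v \<and> head G e = a + 3" using edge_ex by metis
  then have "tail G (exit_edge v) = v \<and> head G (exit_edge v) = a + 3"
    unfolding exit_edge_def by (rule someI)
  then show "tail G (exit_edge v) = v" "head G (exit_edge v) = a + 3" by auto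
qed

lemma link_edge:
  assumes "2 \<le> v" and "v \<le> a + 1"
  shows "tail G (link_edge v) = v" "head G (link_edge v) = Suc v"
proof -
  have "(v, Suc v, 1) \<in> caracol_edges \<nu>"
    using assms unfolding caracol_edges_def Let_def by auto
  then obtain e where "tail G e = v \<and> head G e = Suc v" using edge_ex by metis
  then have "tail G (link_edge v) = v \<and> head G (link_edge v) = Suc v"
    unfolding link_edge_def by (rule someI)
  then show "tail G (link_edge v) = v" "head G (link_edge v) = Suc v" by auto
qed

lemma edge_kinds:
  obtains (source) "e \<in> sources" "2 \<le> head G e" "head G e \<le> a + 2"
  | (exit) v where "e = exit_edge v" "2 \<le> v" "v \<le> a + 2"
  | (link) v where "e = link_edge v" "2 \<le> v" "v \<le> a + 1"
proof (cases e rule: edge_cases)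
  case first then show thesis by (intro source) (auto simp: sources_def)
next
  case jump then show thesis by (intro source) (auto simp: sources_def)
next
  case exit
  have "lab (exit_edge (tail G e)) = 1"
    using exit_edge[OF exit(1,2)] exit(1,2) by (cases "exit_edge (tail G e)" rule: edge_cases) auto
  then have "e = exit_edge (tail G e)"
    using exit exit_edge[OF exit(1,2)] by (intro edge_eqI) auto
  then show thesis using exit that(2) by blast
next
  case link
  have "lab (link_edge (tail G e)) = 1"
    using link_edge[OF link(1,2)] link(1,2) by (cases "link_edge (tail G e)" rule: edge_cases) auto
  then have "e = link_edge (tail G e)"
    using link link_edge[OF link(1,2)] by (intro edge_eqI) auto
  then show thesis using link that(3) by blast
qed

lemma source_head: "e \<in> sources \<Longrightarrow> 2 \<le> head G e \<and> head G e \<le> a + 2"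
  by (cases e rule: edge_cases) (auto simp: sources_def)

lemma out_edge_kinds:
  assumes "tail G e = v" and "2 \<le> v"
  shows "e = exit_edge v \<and> v \<le> a + 2 \<or> e = link_edge v \<and> v \<le> a + 1"
  using assms by (cases e rule: edge_kinds) (auto simp: sources_def exit_edge link_edge)

lemma exit_neq_link:
  "\<lbrakk>2 \<le> v; v \<le> a + 2; 2 \<le> u; u \<le> a + 1\<rbrakk> \<Longrightarrow> exit_edge v \<noteq> link_edge u"
  using exit_edge(2)[of v] link_edge(2)[of u] by auto

lemma source_label_bounds:
  assumes "e \<in> sources"
  shows "lab e < level \<nu> (head G e)"
    and "2 \<le> v \<Longrightarrow> v < head G e \<Longrightarrow> level \<nu> v < level \<nu> (head G e) - lab e"
    and "1 \<le> lab e"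
proof -
  have "lab e < level \<nu> (head G e) \<and> 1 \<le> lab e \<and>
    (2 \<le> v \<longrightarrow> v < head G e \<longrightarrow> level \<nu> v < level \<nu> (head G e) - lab e)"
  proof (cases e rule: edge_cases)
    case first
    then show ?thesis by (simp add: level_2)
  next
    case jump
    then have "level \<nu> (head G e) = Suc (level \<nu> (head G e - 1)) + \<nu> ! (head G e - 3)"
      by (intro level_pred)
    moreover have "level \<nu> v \<le> level \<nu> (head G e - 1)" if "v < head G e"
      using that strict_mono_level by (simp add: strict_mono_less_eq)
    moreover have "2 \<le> level \<nu> (head G e - 1)" using jump by (simp add: level_def)
    ultimately show ?thesis using jump by auto
  qed (use assms in \<open>auto simp: sources_def\<close>)
  then show "lab e < level \<nu> (head G e)" "1 \<le> lab e"
    "2 \<le> v \<Longrightarrow> v < head G e \<Longrightarrow> level \<nu> v < level \<nu> (head G e) - lab e" by auto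
qed

text \<open>
  The position in \<open>E \<nu> N\<close> of the east step that stands for an edge leaving the source. Parallel edges
  occur in the order of decreasing labels. With this choice, of two routes with a common inner vertex
  the one with the later first step precedes the other one on the way in, whether or not their first
  edges are parallel.
\<close>

definition pos :: "'e \<Rightarrow> nat" where
  "pos e = level \<nu> (head G e) - lab e"

lemma pos_less_level_iff:
  assumes "e \<in> sources" and "2 \<le> v"
  shows "pos e < level \<nu> v \<longleftrightarrow> head G e \<le> v"
proof
  assume "pos e < level \<nu> v"
  then show "head G e \<le> v" using source_label_bounds(2)[OF assms(1), of v] assms(2)
    by (force simp: pos_def)
next
  assume "head G e \<le> v"
  then have "level \<nu> (head G e) \<le> level \<nu> v" using strict_mono_level by (simp add: strict_mono_less_eq)
  then show "pos e < level \<nu> v" using source_label_bounds(1,3)[OF assms(1)] by (auto simp: pos_def)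
qed

lemma pos_neq_level:
  assumes "e \<in> sources" and "2 \<le> v"
  shows "pos e \<noteq> level \<nu> v"
proof (cases "head G e \<le> v")
  case True
  then show ?thesis using pos_less_level_iff[OF assms] by simp
next
  case False
  then show ?thesis using source_label_bounds(2)[OF assms(1), of v] assms(2) by (simp add: pos_def)
qed

lemma pos_less_iff:
  assumes "e \<in> sources" and "f \<in> sources"
  shows "pos e < pos f \<longleftrightarrow> head G e < head G f \<or> head G e = head G f \<and> lab f < lab e"
proof (cases "head G e" "head G f" rule: linorder_cases)
  case less
  then have "pos e < level \<nu> (head G e)" "level \<nu> (head G e) < pos f"
    using pos_less_level_iff[OF assms(1), of "head G e"] source_head[OF assms(1)]
      source_label_bounds(2)[OF assms(2), of "head G e"] by (auto simp: pos_def)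
  then show ?thesis using less by simp
next
  case equal
  then show ?thesis using source_label_bounds(1)[OF assms(1)] source_label_bounds(1)[OF assms(2)]
    by (auto simp: pos_def)
next
  case greater
  then have "pos f < level \<nu> (head G f)" "level \<nu> (head G f) < pos e"
    using pos_less_level_iff[OF assms(2), of "head G f"] source_head[OF assms(2)]
      source_label_bounds(2)[OF assms(1), of "head G f"] by (auto simp: pos_def)
  then show ?thesis using greater by simp
qed

lemma inj_pos: "inj_on pos sources"
proof (rule inj_onI)
  fix e f assume *: "e \<in> sources" "f \<in> sources" "pos e = pos f"
  then have "head G e = head G f" "lab e = lab f"
    using pos_less_iff[OF *(1,2)] pos_less_iff[OF *(2,1)] by (auto simp: not_less)
  moreover have "tail G e = tail G f" using * by (simp add: sources_def)
  ultimately show "e = f" by (intro edge_eqI)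
qed

text \<open>
  For the position \<open>p\<close> of an east step, the head of the edge is the least \<open>v \<ge> 2\<close> whose level is at
  least \<open>p\<close>, and the label is the distance from \<open>p\<close> to this level.
\<close>

lemma pos_image: "pos ` sources = path_I \<nu>"
proof
  show "pos ` sources \<subseteq> path_I \<nu>"
  proof
    fix p assume "p \<in> pos ` sources"
    then obtain e where e: "e \<in> sources" "p = pos e" by blast
    have "pos e < level \<nu> (a + 2)"
      using pos_less_level_iff[OF e(1), of "a + 2"] source_head[OF e(1)] by simp
    moreover have "1 \<le> pos e" using source_label_bounds(1)[OF e(1)] by (simp add: pos_def)
    ultimately show "p \<in> path_I \<nu>"
      unfolding path_I_iff using e pos_neq_level[OF e(1)] by simp
  qed
  show "path_I \<nu> \<subseteq> pos ` sources"
  proof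
    fix p assume "p \<in> path_I \<nu>"
    then have p: "1 \<le> p" "p \<le> level \<nu> (a + 2)" "\<And>v. 2 \<le> v \<Longrightarrow> v \<le> a + 2 \<Longrightarrow> p \<noteq> level \<nu> v"
      unfolding path_I_iff by auto
    define v where "v = (LEAST v. 2 \<le> v \<and> p \<le> level \<nu> v)"
    have v: "2 \<le> v \<and> p \<le> level \<nu> v" unfolding v_def
      by (rule LeastI[of _ "a + 2"]) (use p in simp)
    have va: "v \<le> a + 2" unfolding v_def by (rule Least_le) (use p in simp)
    have lt: "p < level \<nu> v" using v va p(3)[of v] by auto
    have "(1, v, level \<nu> v - p) \<in> caracol_edges \<nu>"
    proof (cases "v = 2")
      case True
      then have "p = 1" using lt p(1) by (simp add: level_2)
      then show ?thesis using True by (simp add: caracol_edges_def Let_def level_2)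
    next
      case False
      then have v3: "3 \<le> v" using v by simp
      have "\<not> (2 \<le> v - 1 \<and> p \<le> level \<nu> (v - 1))"
        using v3 unfolding v_def by (intro not_less_Least) simp
      then have "level \<nu> (v - 1) < p" using v3 by linarith
      moreover have "level \<nu> v = Suc (level \<nu> (v - 1)) + \<nu> ! (v - 3)"
        using v3 va by (rule level_pred)
      ultimately have "1 \<le> level \<nu> v - p" "level \<nu> v - p \<le> \<nu> ! (v - 3)"
        using lt by linarith+
      moreover have "v - 3 = v - 2 - 1" by simp
      ultimately have "1 \<le> level \<nu> v - p \<and> level \<nu> v - p \<le> \<nu> ! (v - 2 - 1)" by metis
      moreover have "v = (v - 2) + 2" "1 \<le> v - 2" "v - 2 \<le> a" using v3 va by auto
      ultimately show ?thesis unfolding caracol_edges_def Let_def by blast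
    qed
    then obtain e where e: "tail G e = 1" "head G e = v" "lab e = level \<nu> v - p" using edge_ex by metis
    then have "pos e = p" using lt by (simp add: pos_def)
    then show "p \<in> pos ` sources" using e by (auto simp: sources_def)
  qed
qed

lemma card_sources: "card sources = sum_list \<nu> + 1"
  using card_image[OF inj_pos] by (simp add: pos_image card_path_I)

section \<open>Routes and coherence\<close>

text \<open>
  After its first edge \<open>e\<close> a route can only follow the unit edges up to some vertex \<open>v\<close> and leave for the
  sink from there, so that it is determined by \<open>e\<close> and \<open>v\<close>.
\<close>

definition route :: "'e \<Rightarrow> nat \<Rightarrow> 'e list" where
  "route e v = e # map link_edge [head G e..<v] @ [exit_edge v]"

definition route_ends :: "('e \<times> nat) set" where
  "route_ends = {(e, v). e \<in> sources \<and> head G e \<le> v \<and> v \<le> a + 2}"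

lemma map_tail_links:
  assumes "2 \<le> u" and "v \<le> a + 2"
  shows "map (tail G) (map link_edge [u..<v]) = [u..<v]"
  using assms by (auto intro!: map_idI simp: link_edge)

lemma cas_tail:
  assumes "2 \<le> u" and "u \<le> v" and "v \<le> a + 2"
  shows "pre_digraph.cas G u (map link_edge [u..<v] @ [exit_edge v]) (a + 3)"
  using assms(2,1)
proof (induction u rule: inc_induct)
  case base
  then show ?case using assms by (simp add: pre_digraph.cas.simps exit_edge)
next
  case (step u)
  then show ?case
    using assms by (simp add: pre_digraph.cas.simps upt_conv_Cons link_edge)
qed

lemma cas_tail_form:
  assumes "pre_digraph.cas G u p (a + 3)" and "2 \<le> u" and "u \<le> a + 2"
  shows "\<exists>v. u \<le> v \<and> v \<le> a + 2 \<and> p = map link_edge [u..<v] @ [exit_edge v]"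
  using assms
proof (induction p arbitrary: u)
  case Nil
  then show ?case by (simp add: pre_digraph.cas.simps)
next
  case (Cons e p)
  then have e: "tail G e = u" "pre_digraph.cas G (head G e) p (a + 3)"
    by (simp_all add: pre_digraph.cas.simps)
  from out_edge_kinds[OF e(1) Cons.prems(2)] show ?case
  proof (elim disjE conjE)
    assume "e = exit_edge u"
    moreover have "p = []"
    proof (cases p)
      case (Cons f q)
      then have "tail G f = a + 3"
        using e(2) \<open>e = exit_edge u\<close> exit_edge[of u] \<open>2 \<le> u\<close> \<open>u \<le> a + 2\<close>
        by (simp add: pre_digraph.cas.simps)
      then show ?thesis by (cases f rule: edge_cases) auto
    qed
    ultimately show ?thesis using Cons.prems by (intro exI[of _ u]) simp
  next
    assume l: "e = link_edge u" "u \<le> a + 1"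
    then have "pre_digraph.cas G (Suc u) p (a + 3)" using e(2) link_edge[of u] Cons.prems by simp
    from Cons.IH[OF this] obtain v where "Suc u \<le> v" "v \<le> a + 2"
      "p = map link_edge [Suc u..<v] @ [exit_edge v]" using l Cons.prems by auto
    then show ?thesis using l by (intro exI[of _ v]) (simp add: upt_conv_Cons)
  qed
qed

lemma verts_route:
  assumes "(e, v) \<in> route_ends"
  shows "pre_digraph.awalk_verts G 1 (route e v) = 1 # [head G e..<Suc v] @ [a + 3]"
proof -
  have e: "e \<in> sources" "head G e \<le> v" "v \<le> a + 2" "2 \<le> head G e"
    using assms source_head by (auto simp: route_ends_def)
  have "pre_digraph.awalk_verts G 1 (route e v) = map (tail G) (route e v) @ [head G (exit_edge v)]"
    unfolding pre_digraph.awalk_verts_conv by (simp add: route_def)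
  then show ?thesis
    using e map_tail_links[of "head G e" v] exit_edge[of v] by (simp add: route_def sources_def)
qed

lemma routes_eq: "routes G 1 (a + 3) = (\<lambda>(e, v). route e v) ` route_ends"
proof
  have verts: "verts G = {1..a + 3}" using caracol by (auto simp: is_caracol_def)
  show "routes G 1 (a + 3) \<subseteq> (\<lambda>(e, v). route e v) ` route_ends"
  proof
    fix R assume "R \<in> routes G 1 (a + 3)"
    then have c: "pre_digraph.cas G 1 R (a + 3)"
      by (simp add: routes_def pre_digraph.apath_def pre_digraph.awalk_def)
    then obtain e p where R: "R = e # p" by (cases R) (auto simp: pre_digraph.cas.simps)
    have e: "tail G e = 1" "pre_digraph.cas G (head G e) p (a + 3)"
      using c R by (simp_all add: pre_digraph.cas.simps)
    then have s: "e \<in> sources" by (simp add: sources_def)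
    obtain v where "head G e \<le> v" "v \<le> a + 2" "p = map link_edge [head G e..<v] @ [exit_edge v]"
      using cas_tail_form[OF e(2)] source_head[OF s] by auto
    then show "R \<in> (\<lambda>(e, v). route e v) ` route_ends"
      using s R by (intro image_eqI[of _ _ "(e, v)"]) (auto simp: route_def route_ends_def)
  qed
  show "(\<lambda>(e, v). route e v) ` route_ends \<subseteq> routes G 1 (a + 3)"
  proof clarify
    fix e v assume ev: "(e, v) \<in> route_ends"
    then have e: "e \<in> sources" "head G e \<le> v" "v \<le> a + 2" "2 \<le> head G e"
      using source_head by (auto simp: route_ends_def)
    have "pre_digraph.cas G 1 (route e v) (a + 3)"
      using cas_tail[OF e(4,2,3)] e(1) by (simp add: route_def sources_def pre_digraph.cas.simps)
    moreover have "distinct (pre_digraph.awalk_verts G 1 (route e v))"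
      unfolding verts_route[OF ev] using e by auto
    ultimately show "route e v \<in> routes G 1 (a + 3)"
      by (simp add: routes_def pre_digraph.apath_def pre_digraph.awalk_def verts arcs_UNIV)
  qed
qed

lemma route_split:
  assumes "(e, v) \<in> route_ends" and "head G e \<le> i" and "i \<le> v"
  shows "path_to G i (route e v) = e # map link_edge [head G e..<i]"
    and "path_from G i (route e v) = map link_edge [i..<v] @ [exit_edge v]"
proof -
  have e: "e \<in> sources" "head G e \<le> v" "v \<le> a + 2" "2 \<le> head G e"
    using assms source_head by (auto simp: route_ends_def)
  let ?P = "e # map link_edge [head G e..<i]" and ?Q = "map link_edge [i..<v] @ [exit_edge v]"
  have eq: "route e v = ?P @ ?Q"
    using upt_add_eq_append[of "head G e" i "v - i"] assms(2,3) by (simp add: route_def)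
  have P: "\<forall>f\<in>set ?P. tail G f \<noteq> i"
    using e assms(2,3) by (auto simp: sources_def link_edge)
  have Q: "?Q \<noteq> [] \<and> tail G (hd ?Q) = i"
    using e assms(2,3) by (cases "i = v") (simp_all add: exit_edge link_edge hd_append hd_map)
  show "path_to G i (route e v) = ?P"
    unfolding path_to_def eq using P Q by (subst takeWhile_append2) (auto simp: takeWhile_eq_Nil_iff)
  show "path_from G i (route e v) = ?Q"
    unfolding path_from_def eq using P Q
    by (subst dropWhile_append2) (auto simp: dropWhile_eq_self_iff)
qed

text \<open>
  The route whose first edge has the larger head enters the common part by an edge from \<open>1\<close>, the other
  one by a unit edge; the former is longer. If the heads agree, the labels decide.
\<close>

lemma prec_in_routes:
  assumes "e \<in> sources" "f \<in> sources" "head G e \<le> i" "head G f \<le> i" "i \<le> a + 2"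
  shows "prec_in G (length_in G lab) (e # map link_edge [head G e..<i]) (f # map link_edge [head G f..<i])
    \<longleftrightarrow> pos f < pos e"
proof -
  have split: "e # map link_edge [head G e..<i] =
      (e # map link_edge [head G e..<w - 1]) @ link_edge (w - 1) # map link_edge [w..<i]"
    if "head G e < w" "w \<le> i" for e w
  proof -
    have "[head G e..<i] = [head G e..<w - 1] @ (w - 1) # [w..<i]"
      using that upt_add_eq_append[of "head G e" "w - 1" "i - (w - 1)"] upt_conv_Cons[of "w - 1" i]
      by simp
    then show ?thesis by simp
  qed
  note hs = source_head[OF assms(1)] source_head[OF assms(2)]
  have t: "tail G e = 1" "tail G f = 1" using assms by (simp_all add: sources_def)
  show ?thesis
  proof (cases "head G e" "head G f" rule: linorder_cases)
    case less
    let ?l = "link_edge (head G f - 1)"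
    have l: "tail G ?l = head G f - 1" "head G ?l = head G f"
      using link_edge[of "head G f - 1"] less hs by auto
    have "prec_in G (length_in G lab) (e # map link_edge [head G e..<i])
      ([] @ f # map link_edge [head G f..<i]) \<longleftrightarrow> (?l, f) \<in> length_in G lab (head G ?l)"
      by (rule prec_in_iff[OF split[OF less assms(4)] refl]) (use l t less hs in auto)
    then show ?thesis using pos_less_iff[OF assms(2,1)] l t less hs
      by (auto simp: length_in_def length_order_def arcs_UNIV)
  next
    case equal
    show ?thesis
    proof (cases "e = f")
      case True
      then show ?thesis by (simp add: not_prec_refl)
    next
      case False
      have "prec_in G (length_in G lab) ([] @ e # map link_edge [head G e..<i])
        ([] @ f # map link_edge [head G e..<i]) \<longleftrightarrow> (e, f) \<in> length_in G lab (head G e)"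
        by (rule prec_in_iff[OF refl refl False])
      then show ?thesis using pos_less_iff[OF assms(2,1)] t equal
        by (auto simp: length_in_def length_order_def arcs_UNIV)
    qed
  next
    case greater
    let ?l = "link_edge (head G e - 1)"
    have l: "tail G ?l = head G e - 1" "head G ?l = head G e"
      using link_edge[of "head G e - 1"] greater hs by auto
    have "tail G ?l \<noteq> tail G e" unfolding l t using greater hs by linarith
    then have ne: "?l \<noteq> e" by metis
    have "prec_in G (length_in G lab) ([] @ e # map link_edge [head G e..<i])
      (f # map link_edge [head G f..<i]) \<longleftrightarrow> (e, ?l) \<in> length_in G lab (head G e)"
      by (rule prec_in_iff[OF refl split[OF greater assms(3)] ne[symmetric]])
    then show ?thesis using pos_less_iff[OF assms(2,1)] l t greater hs
      by (auto simp: length_in_def length_order_def arcs_UNIV)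
  qed
qed

text \<open>
  At the smaller one of \<open>u\<close> and \<open>v\<close> one path leaves for the sink and the other one takes the unit edge;
  the edge to the sink is longer.
\<close>

lemma prec_out_routes:
  assumes "2 \<le> i" "i \<le> u" "i \<le> v" "u \<le> a + 2" "v \<le> a + 2"
  shows "prec_out G (length_out G lab) (map link_edge [i..<u] @ [exit_edge u])
    (map link_edge [i..<v] @ [exit_edge v]) \<longleftrightarrow> u < v"
proof -
  have split: "map link_edge [i..<v] @ [exit_edge v] =
      map link_edge [i..<u] @ link_edge u # map link_edge [Suc u..<v] @ [exit_edge v]"
    if "i \<le> u" "u < v" for u v
    using that upt_add_eq_append[of i u "v - u"] upt_conv_Cons[of u v] by simp
  show ?thesis
  proof (cases u v rule: linorder_cases)
    case less
    have ne: "exit_edge u \<noteq> link_edge u" using less assms by (intro exit_neq_link) auto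
    show ?thesis
      unfolding prec_out_iff[OF refl split[OF assms(2) less] ne]
      using less assms exit_edge[of u] link_edge[of u]
      by (auto simp: length_out_def length_order_def arcs_UNIV)
  next
    case equal
    then show ?thesis by (simp add: not_prec_refl)
  next
    case greater
    have ne: "link_edge v \<noteq> exit_edge v" using greater assms exit_neq_link[of v v] by auto
    show ?thesis
      unfolding prec_out_iff[OF split[OF assms(3) greater] refl ne]
      using greater assms exit_edge[of v] link_edge[of v]
      by (auto simp: length_out_def length_order_def arcs_UNIV)
  qed
qed

text \<open>
  The order of two routes before and after a common inner vertex is the same for all such vertices, so
  incoherence is a comparison of the two pairs of ends together with the existence of a common inner
  vertex.
\<close>

lemma coherent_routes_iff:
  assumes "(e, u) \<in> route_ends" and "(f, v) \<in> route_ends"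
  shows "coherent G 1 (a + 3) (length_in G lab) (length_out G lab) (route e u) (route f v) \<longleftrightarrow>
    \<not> (pos e < pos f \<and> head G f \<le> u \<and> u < v) \<and> \<not> (pos f < pos e \<and> head G e \<le> v \<and> v < u)"
proof -
  have e: "e \<in> sources" "head G e \<le> u" "u \<le> a + 2" "2 \<le> head G e"
    and f: "f \<in> sources" "head G f \<le> v" "v \<le> a + 2" "2 \<le> head G f"
    using assms source_head by (auto simp: route_ends_def)
  have common: "inner_verts G 1 (a + 3) \<inter> set (pre_digraph.awalk_verts G 1 (route e u))
      \<inter> set (pre_digraph.awalk_verts G 1 (route f v)) =
      {i. head G e \<le> i \<and> head G f \<le> i \<and> i \<le> u \<and> i \<le> v}"
    unfolding verts_route[OF assms(1)] verts_route[OF assms(2)]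
    using caracol e f by (auto simp: inner_verts_def is_caracol_def)
  have at: "coherent_at G (length_in G lab) (length_out G lab) i (route e u) (route f v) \<longleftrightarrow>
      \<not> (pos f < pos e \<and> v < u) \<and> \<not> (pos e < pos f \<and> u < v)"
    if "head G e \<le> i" "head G f \<le> i" "i \<le> u" "i \<le> v" for i
  proof -
    have i: "2 \<le> i" "i \<le> a + 2" using that e by auto
    show ?thesis
      unfolding coherent_at_def
        route_split[OF assms(1) that(1,3)] route_split[OF assms(2) that(2,4)]
        prec_in_routes[OF e(1) f(1) that(1,2) i(2)] prec_in_routes[OF f(1) e(1) that(2,1) i(2)]
        prec_out_routes[OF i(1) that(3,4) e(3) f(3)] prec_out_routes[OF i(1) that(4,3) f(3) e(3)]
      by blast
  qed
  have "coherent G 1 (a + 3) (length_in G lab) (length_out G lab) (route e u) (route f v) \<longleftrightarrow>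
    (\<forall>i. head G e \<le> i \<and> head G f \<le> i \<and> i \<le> u \<and> i \<le> v \<longrightarrow>
      \<not> (pos f < pos e \<and> v < u) \<and> \<not> (pos e < pos f \<and> u < v))"
    unfolding coherent_def common using at by auto
  also have "\<dots> \<longleftrightarrow>
    \<not> (pos e < pos f \<and> head G f \<le> u \<and> u < v) \<and> \<not> (pos f < pos e \<and> head G e \<le> v \<and> v < u)"
    (is "?L = ?R")
  proof
    assume L: ?L
    show ?R
    proof (intro conjI notI; elim conjE)
      assume *: "pos e < pos f" "head G f \<le> u" "u < v"
      then show False using L[rule_format, of u] e by simp
    next
      assume *: "pos f < pos e" "head G e \<le> v" "v < u"
      then show False using L[rule_format, of v] f by simp
    qed
  qed auto
  finally show ?thesis .
qed

section \<open>Flows\<close>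

definition conserved :: "(real^'e) set" where
  "conserved = {x. \<forall>j\<in>{2..a + 2}. (\<Sum>e\<in>out_arcs G j. x $ e) = (\<Sum>e\<in>in_arcs G j. x $ e)}"

lemma flow_polytope_eq:
  "flow_polytope G 1 (a + 3) =
    {x. (\<forall>e. 0 \<le> x $ e) \<and> (\<Sum>e\<in>sources. x $ e) = 1 \<and> x \<in> conserved}"
proof -
  have "inner_verts G 1 (a + 3) = {2..a + 2}"
    using caracol by (auto simp: inner_verts_def is_caracol_def)
  moreover have "out_arcs G 1 = sources" by (auto simp: sources_def arcs_UNIV)
  ultimately show ?thesis by (simp add: flow_polytope_def conserved_def)
qed

lemma subspace_conserved: "subspace conserved"
  unfolding subspace_def conserved_def
  by (auto simp: sum.distrib sum_distrib_left[symmetric])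

text \<open>
  The flow on the unit edge from \<open>j\<close> to \<open>j + 1\<close>, set to \<open>0\<close> at both ends of the range of inner unit edges, so
  that the conservation law has the same form at all inner vertices.
\<close>

definition link_flow :: "real^'e \<Rightarrow> nat \<Rightarrow> real" where
  "link_flow x j = (if 2 \<le> j \<and> j \<le> a + 1 then x $ link_edge j else 0)"

lemma sum_out_arcs:
  assumes "2 \<le> j" "j \<le> a + 2"
  shows "(\<Sum>e\<in>out_arcs G j. x $ e) = x $ exit_edge j + link_flow x j"
proof -
  have out: "out_arcs G j = (if j \<le> a + 1 then {exit_edge j, link_edge j} else {exit_edge j})"
    (is "_ = ?R")
  proof
    show "out_arcs G j \<subseteq> ?R"
    proof
      fix e assume "e \<in> out_arcs G j"
      then have "tail G e = j" by simp
      from out_edge_kinds[OF this assms(1)] show "e \<in> ?R" by (elim disjE conjE) simp_all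
    qed
    show "?R \<subseteq> out_arcs G j"
      using exit_edge(1)[OF assms] link_edge(1)[OF assms(1)] by (simp add: arcs_UNIV)
  qed
  show ?thesis
    using assms exit_neq_link[of j j] unfolding out link_flow_def by simp
qed

lemma sum_in_arcs:
  assumes "2 \<le> j" "j \<le> a + 2"
  shows "(\<Sum>e\<in>in_arcs G j. x $ e) = (\<Sum>e\<in>{e \<in> sources. head G e = j}. x $ e) + link_flow x (j - 1)"
proof (cases "j = 2")
  case True
  have "in_arcs G j = {e \<in> sources. head G e = j}"
  proof -
    have "e \<in> sources" if "head G e = j" for e
      using that unfolding True by (cases e rule: edge_cases) (auto simp: sources_def)
    then show ?thesis by (auto simp: arcs_UNIV)
  qed
  then show ?thesis using True by (simp add: link_flow_def)
next
  case False
  have l: "tail G (link_edge (j - 1)) = j - 1" "head G (link_edge (j - 1)) = j"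
    using link_edge[of "j - 1"] assms False by auto
  have ns: "link_edge (j - 1) \<notin> sources" using l False assms by (auto simp: sources_def)
  have *: "e \<in> sources \<or> e = link_edge (j - 1)" if "head G e = j" for e
    using that assms by (cases e rule: edge_kinds) (auto simp: exit_edge link_edge)
  have "in_arcs G j = insert (link_edge (j - 1)) {e \<in> sources. head G e = j}" (is "_ = ?R")
  proof
    show "in_arcs G j \<subseteq> ?R"
    proof
      fix e assume "e \<in> in_arcs G j"
      then have "head G e = j" by simp
      with *[OF this] show "e \<in> ?R" by (elim disjE) simp_all
    qed
    show "?R \<subseteq> in_arcs G j" using l(2) by (simp add: arcs_UNIV subset_iff)
  qed
  moreover have "2 \<le> j - 1 \<and> j - 1 \<le> a + 1" using assms False by linarith
  ultimately show ?thesis using ns by (simp add: link_flow_def)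
qed

text \<open>
  What passes from \<open>j\<close> to \<open>j + 1\<close> is what has entered at \<open>2, \<dots>, j\<close> from the source minus what has left from
  there to the sink. Hence a flow is determined by its values on the edges at the source and at the
  sink, and nonnegativity on the unit edges means that the supply always covers the demand so far.
\<close>

lemma link_flow_eq:
  assumes x: "x \<in> conserved" and "1 \<le> j" "j \<le> a + 2"
  shows "link_flow x j =
    (\<Sum>e\<in>{e \<in> sources. head G e \<le> j}. x $ e) - (\<Sum>v\<in>{2..j}. x $ exit_edge v)"
  using assms(2,3)
proof (induction j rule: dec_induct)
  case base
  have "{e \<in> sources. head G e \<le> 1} = {}" using source_head by fastforce
  then show ?case by (simp only: link_flow_def) simp
next
  case (step j)
  have "{e \<in> sources. head G e \<le> Suc j} =
    {e \<in> sources. head G e \<le> j} \<union> {e \<in> sources. head G e = Suc j}" by auto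
  then have s: "(\<Sum>e\<in>{e \<in> sources. head G e \<le> Suc j}. x $ e) =
    (\<Sum>e\<in>{e \<in> sources. head G e \<le> j}. x $ e) + (\<Sum>e\<in>{e \<in> sources. head G e = Suc j}. x $ e)"
    by (simp only:) (rule sum.union_disjoint; auto)
  have "(\<Sum>e\<in>out_arcs G (Suc j). x $ e) = (\<Sum>e\<in>in_arcs G (Suc j). x $ e)"
    using x step by (auto simp: conserved_def)
  then have "x $ exit_edge (Suc j) + link_flow x (Suc j) =
    (\<Sum>e\<in>{e \<in> sources. head G e = Suc j}. x $ e) + link_flow x j"
    using sum_out_arcs[of "Suc j" x] sum_in_arcs[of "Suc j" x] step by simp
  moreover have "(\<Sum>v\<in>{2..Suc j}. x $ exit_edge v) = (\<Sum>v\<in>{2..j}. x $ exit_edge v) + x $ exit_edge (Suc j)"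
    using step(1) by (simp add: sum.nat_ivl_Suc')
  ultimately show ?case using s step by simp
qed

lemma conserved_total:
  assumes "x \<in> conserved"
  shows "(\<Sum>e\<in>sources. x $ e) = (\<Sum>v\<in>{2..a + 2}. x $ exit_edge v)"
proof -
  have "{e \<in> sources. head G e \<le> a + 2} = sources" using source_head by blast
  then show ?thesis using link_flow_eq[OF assms, of "a + 2"] by (simp add: link_flow_def)
qed

lemma conserved_eqI:
  assumes "x \<in> conserved" "y \<in> conserved"
    and "\<And>e. e \<in> sources \<Longrightarrow> x $ e = y $ e"
    and "\<And>v. 2 \<le> v \<Longrightarrow> v \<le> a + 2 \<Longrightarrow> x $ exit_edge v = y $ exit_edge v"
  shows "x = y"
proof -
  have "x $ e = y $ e" for e
  proof (cases e rule: edge_kinds)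
    case (link v)
    then have "link_flow x v = link_flow y v"
      using assms by (simp add: link_flow_eq)
    then show ?thesis using link by (simp add: link_flow_def)
  qed (use assms in auto)
  then show ?thesis by (simp add: vec_eq_iff)
qed

lemma route_vector_entries:
  assumes "(e, v) \<in> route_ends"
  shows "f \<in> sources \<Longrightarrow> route_vector (route e v) $ f = (if f = e then 1 else 0)"
    and "\<lbrakk>2 \<le> u; u \<le> a + 2\<rbrakk> \<Longrightarrow> route_vector (route e v) $ exit_edge u = (if u = v then 1 else 0)"
    and "\<lbrakk>2 \<le> u; u \<le> a + 1\<rbrakk> \<Longrightarrow>
      route_vector (route e v) $ link_edge u = (if head G e \<le> u \<and> u < v then 1 else 0)"
proof -
  have e: "e \<in> sources" "head G e \<le> v" "v \<le> a + 2" "2 \<le> head G e"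
    using assms source_head by (auto simp: route_ends_def)
  have set: "set (route e v) = {e} \<union> link_edge ` {head G e..<v} \<union> {exit_edge v}"
    by (auto simp: route_def)
  have tails: "tail G e = 1" "tail G (exit_edge v) = v"
    "\<And>w. w \<in> {head G e..<v} \<Longrightarrow> tail G (link_edge w) = w"
    using e by (auto simp: sources_def exit_edge link_edge)
  show "route_vector (route e v) $ f = (if f = e then 1 else 0)" if "f \<in> sources"
  proof -
    have "f \<in> set (route e v) \<longleftrightarrow> f = e"
      unfolding set using that tails e by (auto simp: sources_def)
    then show ?thesis by (simp add: route_vector_def)
  qed
  show "route_vector (route e v) $ exit_edge u = (if u = v then 1 else 0)" if u: "2 \<le> u" "u \<le> a + 2"
  proof -
    have "exit_edge u \<noteq> e" using exit_edge(1)[OF u] tails(1) u by auto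
    moreover have "exit_edge u \<noteq> link_edge w" if "w \<in> {head G e..<v}" for w
      using exit_neq_link[OF u] that e by auto
    moreover have "exit_edge u = exit_edge v \<Longrightarrow> u = v" using exit_edge(1)[OF u] tails(2) by metis
    ultimately have "exit_edge u \<in> set (route e v) \<longleftrightarrow> u = v" unfolding set by blast
    then show ?thesis by (simp add: route_vector_def)
  qed
  show "route_vector (route e v) $ link_edge u = (if head G e \<le> u \<and> u < v then 1 else 0)"
    if u: "2 \<le> u" "u \<le> a + 1"
  proof -
    have "link_edge u \<noteq> e" using link_edge(1)[OF u] tails(1) u by auto
    moreover have "link_edge u \<noteq> exit_edge v" using exit_neq_link[of v u] u e by auto
    moreover have "link_edge u \<in> link_edge ` {head G e..<v} \<longleftrightarrow> u \<in> {head G e..<v}"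
    proof
      assume "link_edge u \<in> link_edge ` {head G e..<v}"
      then obtain w where w: "w \<in> {head G e..<v}" "link_edge u = link_edge w" by (rule imageE)
      have "u = w" using link_edge(1)[OF u] tails(3)[OF w(1)] unfolding w(2) by (rule trans[OF sym])
      then show "u \<in> {head G e..<v}" using w(1) by (rule ssubst)
    qed (rule imageI)
    ultimately have "link_edge u \<in> set (route e v) \<longleftrightarrow> u \<in> {head G e..<v}" unfolding set by blast
    then show ?thesis by (simp add: route_vector_def)
  qed
qed

lemma route_vector_in_polytope:
  assumes ev: "(e, v) \<in> route_ends"
  shows "route_vector (route e v) \<in> flow_polytope G 1 (a + 3)"
proof -
  let ?x = "route_vector (route e v)"
  have e: "e \<in> sources" "head G e \<le> v" "v \<le> a + 2" "2 \<le> head G e"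
    using assms source_head by (auto simp: route_ends_def)
  have src: "(\<Sum>f\<in>S. ?x $ f) = (if e \<in> S then 1 else 0)" if "S \<subseteq> sources" for S
  proof -
    have "(\<Sum>f\<in>S. ?x $ f) = (\<Sum>f\<in>S. if f = e then 1 else 0)"
      using that route_vector_entries(1)[OF ev] by (intro sum.cong) auto
    then show ?thesis by simp
  qed
  have lk: "link_flow ?x j = (if head G e \<le> j \<and> j < v then 1 else 0)" for j
    using e route_vector_entries(3)[OF ev] by (auto simp: link_flow_def)
  have "(\<Sum>f\<in>out_arcs G j. ?x $ f) = (\<Sum>f\<in>in_arcs G j. ?x $ f)" if j: "2 \<le> j" "j \<le> a + 2" for j
  proof -
    have "(\<Sum>f\<in>out_arcs G j. ?x $ f) = (if head G e \<le> j \<and> j \<le> v then 1 else 0)"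
      unfolding sum_out_arcs[OF j] lk route_vector_entries(2)[OF ev j] using e by auto
    moreover have "(\<Sum>f\<in>in_arcs G j. ?x $ f) = (if head G e \<le> j \<and> j \<le> v then 1 else 0)"
      unfolding sum_in_arcs[OF j] lk using src[of "{f \<in> sources. head G f = j}"] e j by auto
    ultimately show ?thesis by simp
  qed
  then show ?thesis
    unfolding flow_polytope_eq conserved_def using src[of sources] e by (auto simp: route_vector_def)
qed

section \<open>Routes as arcs\<close>

abbreviation "X \<equiv> arcs_between (path_I \<nu>) (path_J \<nu>)"
abbreviation "K \<equiv> tamari_complex (path_I \<nu>) (path_J \<nu>)"

definition source_at :: "nat \<Rightarrow> 'e" where
  "source_at = inv_into sources pos"

definition exit_at :: "nat \<Rightarrow> nat" where
  "exit_at = inv_into {2..a + 2} (level \<nu>)"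

lemma source_at: "e \<in> sources \<Longrightarrow> source_at (pos e) = e"
  unfolding source_at_def using inj_pos by simp

lemma exit_at: "2 \<le> v \<Longrightarrow> v \<le> a + 2 \<Longrightarrow> exit_at (level \<nu> v) = v"
  unfolding exit_at_def using strict_mono_level[of \<nu>]
  by (intro inv_into_f_f) (auto intro: strict_mono_imp_inj_on inj_on_subset)

lemma arcs_route_ends:
  assumes "p \<in> X"
  obtains e v where "(e, v) \<in> route_ends" "p = (pos e, level \<nu> v)"
proof -
  obtain i j where ij: "p = (i, j)" "i \<in> path_I \<nu>" "j \<in> path_J \<nu>" "i < j"
    using assms by (auto simp: arcs_between_def)
  then obtain e v where "e \<in> sources" "i = pos e" "j = level \<nu> v" "2 \<le> v" "v \<le> a + 2"
    unfolding pos_image[symmetric] path_J_eq by auto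
  then show thesis using that ij pos_less_level_iff[of e v] by (simp add: route_ends_def)
qed

lemma route_ends_arcs:
  assumes "(e, v) \<in> route_ends"
  shows "(pos e, level \<nu> v) \<in> X"
proof -
  have e: "e \<in> sources" "head G e \<le> v" "v \<le> a + 2" "2 \<le> v"
    using assms source_head by (auto simp: route_ends_def intro: order_trans)
  then show ?thesis
    using pos_less_level_iff[of e v]
    by (auto simp: arcs_between_def pos_image[symmetric] path_J_eq)
qed

definition route_of :: "nat \<times> nat \<Rightarrow> 'e list" where
  "route_of p = route (source_at (fst p)) (exit_at (snd p))"

lemma route_of:
  assumes "(e, v) \<in> route_ends"
  shows "route_of (pos e, level \<nu> v) = route e v"
proof -
  have "e \<in> sources" "v \<le> a + 2" "2 \<le> v"
    using assms source_head by (auto simp: route_ends_def intro: order_trans)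
  then show ?thesis by (simp add: route_of_def source_at exit_at)
qed

lemma routes_eq_image: "routes G 1 (a + 3) = route_of ` X"
proof
  show "routes G 1 (a + 3) \<subseteq> route_of ` X"
    unfolding routes_eq using route_of route_ends_arcs by force
  show "route_of ` X \<subseteq> routes G 1 (a + 3)"
  proof
    fix R assume "R \<in> route_of ` X"
    then obtain p where p: "p \<in> X" "R = route_of p" by blast
    from p(1) obtain e v where "(e, v) \<in> route_ends" "p = (pos e, level \<nu> v)"
      by (rule arcs_route_ends)
    then show "R \<in> routes G 1 (a + 3)" unfolding routes_eq using p route_of by force
  qed
qed

abbreviation compatible :: "'e list \<Rightarrow> 'e list \<Rightarrow> bool" where
  "compatible \<equiv> coherent G 1 (a + 3) (length_in G lab) (length_out G lab)"

text \<open>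
  In terms of positions the condition that the routes have a common inner vertex becomes the middle
  inequality of a crossing.
\<close>

lemma compatible_iff_noncrossing:
  assumes "(i, j) \<in> X" and "(i', j') \<in> X"
  shows "compatible (route_of (i, j)) (route_of (i', j')) \<longleftrightarrow>
    \<not> (i < i' \<and> i' < j \<and> j < j') \<and> \<not> (i' < i \<and> i < j' \<and> j' < j)"
proof -
  obtain e u where e: "(e, u) \<in> route_ends" "(i, j) = (pos e, level \<nu> u)"
    using assms(1) by (rule arcs_route_ends)
  obtain f v where f: "(f, v) \<in> route_ends" "(i', j') = (pos f, level \<nu> v)"
    using assms(2) by (rule arcs_route_ends)
  have b: "e \<in> sources" "2 \<le> u" "f \<in> sources" "2 \<le> v"
    using e f source_head by (auto simp: route_ends_def intro: order_trans)
  have "level \<nu> u < level \<nu> v \<longleftrightarrow> u < v" "level \<nu> v < level \<nu> u \<longleftrightarrow> v < u"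
    using strict_mono_level by (simp_all add: strict_mono_less)
  then show ?thesis
    unfolding e(2) f(2) route_of[OF e(1)] route_of[OF f(1)] coherent_routes_iff[OF e(1) f(1)]
    using e(2) f(2) pos_less_level_iff[OF b(1,4)] pos_less_level_iff[OF b(3,2)] by auto
qed

lemma clique_iff:
  "clique G 1 (a + 3) (length_in G lab) (length_out G lab) C \<longleftrightarrow> (\<exists>A\<in>K. C = route_of ` A)"
proof
  assume "clique G 1 (a + 3) (length_in G lab) (length_out G lab) C"
  then have C: "C \<subseteq> route_of ` X" "\<And>R Q. R \<in> C \<Longrightarrow> Q \<in> C \<Longrightarrow> compatible R Q"
    unfolding clique_def routes_eq_image by blast+
  then obtain A where A: "A \<subseteq> X" "C = route_of ` A" by (auto simp: subset_image_iff)
  have "A \<in> K"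
    unfolding tamari_complex_iff
  proof (intro conjI A(1) allI impI)
    fix i j i' j' assume *: "(i, j) \<in> A" "(i', j') \<in> A" "i < i'" "i' < j" "j < j'"
    then show False
      using compatible_iff_noncrossing[of i j i' j'] C(2)[of "route_of (i, j)" "route_of (i', j')"] A
      by blast
  qed
  then show "\<exists>A\<in>K. C = route_of ` A" using A by blast
next
  assume "\<exists>A\<in>K. C = route_of ` A"
  then obtain A where A: "A \<in> K" "C = route_of ` A" by blast
  have AX: "A \<subseteq> X" using A(1) by (simp add: tamari_complex_iff)
  have "compatible (route_of p) (route_of q)" if pq: "p \<in> A" "q \<in> A" for p q
  proof -
    obtain i j i' j' where ij: "p = (i, j)" "q = (i', j')" by fastforce
    have X: "(i, j) \<in> X" "(i', j') \<in> X" using pq ij AX by auto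
    show ?thesis
      unfolding ij compatible_iff_noncrossing[OF X]
      using A(1) pq ij unfolding tamari_complex_iff by blast
  qed
  then show "clique G 1 (a + 3) (length_in G lab) (length_out G lab) C"
    unfolding clique_def routes_eq_image A(2) using AX by blast
qed

section \<open>The triangulation\<close>

definition place :: "nat \<times> nat \<Rightarrow> real^'e" where
  "place p = route_vector (route_of p)"

lemma finite_X: "finite X"
  by (simp add: finite_arcs_between finite_paths)

lemma place_entries:
  assumes "p \<in> X"
  shows "e \<in> sources \<Longrightarrow> place p $ e = (if fst p = pos e then 1 else 0)"
    and "\<lbrakk>2 \<le> v; v \<le> a + 2\<rbrakk> \<Longrightarrow> place p $ exit_edge v = (if snd p = level \<nu> v then 1 else 0)"
    and "place p \<in> flow_polytope G 1 (a + 3)"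
proof -
  obtain f u where f: "(f, u) \<in> route_ends" "p = (pos f, level \<nu> u)"
    using assms by (rule arcs_route_ends)
  have fs: "f \<in> sources" using f by (simp add: route_ends_def)
  show "place p $ e = (if fst p = pos e then 1 else 0)" if "e \<in> sources"
    using f route_of[OF f(1)] route_vector_entries(1)[OF f(1) that] inj_onD[OF inj_pos _ fs that]
    by (auto simp: place_def)
  show "place p $ exit_edge v = (if snd p = level \<nu> v then 1 else 0)" if "2 \<le> v" "v \<le> a + 2"
    using f route_of[OF f(1)] route_vector_entries(2)[OF f(1) that] strict_mono_eq[OF strict_mono_level]
    by (auto simp: place_def)
  show "place p \<in> flow_polytope G 1 (a + 3)"
    using f route_of[OF f(1)] route_vector_in_polytope[OF f(1)] by (simp add: place_def)
qed

lemma place_sum_entries: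
  shows "e \<in> sources \<Longrightarrow> (\<Sum>p\<in>X. u p *\<^sub>R place p) $ e = sum u {p \<in> X. fst p = pos e}"
    and "\<lbrakk>2 \<le> v; v \<le> a + 2\<rbrakk> \<Longrightarrow>
      (\<Sum>p\<in>X. u p *\<^sub>R place p) $ exit_edge v = sum u {p \<in> X. snd p = level \<nu> v}"
proof -
  show "(\<Sum>p\<in>X. u p *\<^sub>R place p) $ e = sum u {p \<in> X. fst p = pos e}" if "e \<in> sources"
  proof -
    have "(\<Sum>p\<in>X. u p *\<^sub>R place p) $ e = (\<Sum>p\<in>X. if fst p = pos e then u p else 0)"
      using place_entries(1)[OF _ that] by (auto intro!: sum.cong)
    then show ?thesis using finite_X by (simp add: sum.inter_filter)
  qed
  show "(\<Sum>p\<in>X. u p *\<^sub>R place p) $ exit_edge v = sum u {p \<in> X. snd p = level \<nu> v}"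
    if "2 \<le> v" "v \<le> a + 2"
  proof -
    have "(\<Sum>p\<in>X. u p *\<^sub>R place p) $ exit_edge v = (\<Sum>p\<in>X. if snd p = level \<nu> v then u p else 0)"
      using place_entries(2)[OF _ that] by (auto intro!: sum.cong)
    then show ?thesis using finite_X by (simp add: sum.inter_filter)
  qed
qed

text \<open>
  The source and sink coordinates of a convex combination of routes are the row and column sums of its
  weights, and noncrossing weights are determined by these sums.
\<close>

lemma placement: "barycentric_placement K place"
proof
  show "finite (\<Union>K)" by (simp add: Union_tamari_complex finite_X)
  show "B \<in> K" if "A \<in> K" "B \<subseteq> A" for A B using that by (rule tamari_complex_subset)
  fix u w p
  assume "\<And>v. v \<in> \<Union>K \<Longrightarrow> 0 \<le> u v" "\<And>v. v \<in> \<Union>K \<Longrightarrow> 0 \<le> w v"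
    "{v \<in> \<Union>K. u v \<noteq> 0} \<in> K" "{v \<in> \<Union>K. w v \<noteq> 0} \<in> K"
    "sum u (\<Union>K) = 1" "sum w (\<Union>K) = 1"
    and "(\<Sum>v\<in>\<Union>K. u v *\<^sub>R place v) = (\<Sum>v\<in>\<Union>K. w v *\<^sub>R place v)" "p \<in> \<Union>K"
  note * = this[unfolded Union_tamari_complex]
  show "u p = w p"
  proof (rule noncrossing_matching_unique[OF finite_paths *(1-4) _ _ *(8)])
    fix i assume "i \<in> path_I \<nu>"
    then obtain e where "e \<in> sources" "i = pos e" unfolding pos_image[symmetric] by blast
    then show "sum u {p \<in> X. fst p = i} = sum w {p \<in> X. fst p = i}"
      using place_sum_entries(1)[of e u] place_sum_entries(1)[of e w] *(7) by simp
  next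
    fix j assume "j \<in> path_J \<nu>"
    then obtain v where "2 \<le> v" "v \<le> a + 2" "j = level \<nu> v" unfolding path_J_eq by auto
    then show "sum u {p \<in> X. snd p = j} = sum w {p \<in> X. snd p = j}"
      using place_sum_entries(2)[of v u] place_sum_entries(2)[of v w] *(7) by simp
  qed auto
qed

text \<open>
  The flow on the source edges is a supply and the flow on the edges to the sink is a demand; a
  noncrossing matching gives the weights of a combination of routes with the same values on these edges.
\<close>

lemma polytope_point_in_face:
  assumes x: "x \<in> flow_polytope G 1 (a + 3)"
  shows "\<exists>A\<in>K. x \<in> convex hull (place ` A)"
proof -
  interpret barycentric_placement K place by (rule placement)
  have x0: "\<And>e. 0 \<le> x $ e" and x1: "(\<Sum>e\<in>sources. x $ e) = 1" and xc: "x \<in> conserved"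
    using x unfolding flow_polytope_eq by blast+
  define f where "f i = x $ source_at i" for i
  define g where "g j = x $ exit_edge (exit_at j)" for j
  have sum_f: "sum f (pos ` S) = (\<Sum>e\<in>S. x $ e)" if "S \<subseteq> sources" for S
    unfolding sum.reindex[OF inj_on_subset[OF inj_pos that]]
    using that source_at by (intro sum.cong) (auto simp: f_def)
  have sum_g: "sum g (level \<nu> ` {2..v}) = (\<Sum>u\<in>{2..v}. x $ exit_edge u)" if "v \<le> a + 2" for v
  proof -
    have "inj_on (level \<nu>) {2..v}"
      using strict_mono_level by (auto intro: strict_mono_imp_inj_on inj_on_subset)
    then show ?thesis using that exit_at by (auto simp: sum.reindex g_def intro!: sum.cong)
  qed
  have "\<exists>c. (\<forall>p\<in>X. 0 \<le> c p) \<and> {p \<in> X. c p \<noteq> 0} \<in> K \<and>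
    (\<forall>i\<in>path_I \<nu>. sum c {p \<in> X. fst p = i} = f i) \<and>
    (\<forall>j\<in>path_J \<nu>. sum c {p \<in> X. snd p = j} = g j)"
  proof (rule noncrossing_matching_exists[OF finite_paths])
    show "0 \<le> f i" "0 \<le> g j" for i j using x0 by (simp_all add: f_def g_def)
    show "sum f (path_I \<nu>) = sum g (path_J \<nu>)"
      unfolding pos_image[symmetric] path_J_eq
      using sum_f[of sources] sum_g[of "a + 2"] conserved_total[OF xc] by simp
    fix j assume "j \<in> path_J \<nu>"
    then obtain v where v: "2 \<le> v" "v \<le> a + 2" "j = level \<nu> v" unfolding path_J_eq by auto
    have "{j' \<in> path_J \<nu>. j' \<le> j} = level \<nu> ` {2..v}"
      unfolding path_J_eq using v strict_mono_less_eq[OF strict_mono_level] by auto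
    moreover have "{i \<in> path_I \<nu>. i < j} = pos ` {e \<in> sources. head G e \<le> v}"
      unfolding pos_image[symmetric] using v pos_less_level_iff by auto
    moreover have "0 \<le> link_flow x v" using x0 by (simp add: link_flow_def)
    ultimately show "sum g {j' \<in> path_J \<nu>. j' \<le> j} \<le> sum f {i \<in> path_I \<nu>. i < j}"
      using link_flow_eq[OF xc, of v] v sum_g[of v] sum_f[of "{e \<in> sources. head G e \<le> v}"] by simp
  qed
  then obtain c where c: "\<And>p. p \<in> X \<Longrightarrow> 0 \<le> c p" "{p \<in> X. c p \<noteq> 0} \<in> K"
    "\<And>i. i \<in> path_I \<nu> \<Longrightarrow> sum c {p \<in> X. fst p = i} = f i"
    "\<And>j. j \<in> path_J \<nu> \<Longrightarrow> sum c {p \<in> X. snd p = j} = g j" by blast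
  have "(\<Sum>p\<in>X. c p *\<^sub>R place p) = x"
  proof (rule conserved_eqI)
    show "(\<Sum>p\<in>X. c p *\<^sub>R place p) \<in> conserved"
      using place_entries(3) unfolding flow_polytope_eq
      by (intro subspace_sum subspace_conserved subspace_scale) auto
    show "(\<Sum>p\<in>X. c p *\<^sub>R place p) $ e = x $ e" if "e \<in> sources" for e
      using place_sum_entries(1)[OF that] c(3)[of "pos e"] that source_at[OF that]
      by (simp add: pos_image[symmetric] f_def)
    show "(\<Sum>p\<in>X. c p *\<^sub>R place p) $ exit_edge v = x $ exit_edge v" if "2 \<le> v" "v \<le> a + 2" for v
      using place_sum_entries(2)[OF that] c(4)[of "level \<nu> v"] that exit_at[OF that]
      by (simp add: path_J_eq g_def)
  qed (rule xc)
  moreover have "sum c X = 1"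
  proof -
    have "sum c X = (\<Sum>i\<in>path_I \<nu>. sum c {p \<in> X. fst p = i})"
      by (rule sum.group[OF finite_X finite_paths(1), symmetric]) (auto simp: arcs_between_def)
    also have "\<dots> = sum f (pos ` sources)" using c(3) by (simp add: pos_image)
    finally show ?thesis using sum_f[of sources] x1 by simp
  qed
  ultimately have "x \<in> convex hull (place ` {p \<in> X. c p \<noteq> 0})"
    using weights_in_face_hull[OF c(2), of c] c(1) by (auto simp: Union_tamari_complex)
  then show ?thesis using c(2) by blast
qed

definition facets :: "(nat \<times> nat) set set" where
  "facets = {A \<in> K. \<forall>B\<in>K. A \<subseteq> B \<longrightarrow> B = A}"

lemma face_in_facet:
  assumes "A \<in> K"
  obtains B where "B \<in> facets" "A \<subseteq> B"
  using finite_has_maximal2[OF finite_tamari_complex[OF finite_paths] assms]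
  unfolding facets_def by auto

lemma card_facet:
  assumes A: "A \<in> facets"
  shows "card A = a + sum_list \<nu> + 1"
proof -
  have "(1, 2, 1) \<in> caracol_edges \<nu>" by (simp add: caracol_edges_def Let_def)
  then obtain e where e: "tail G e = 1" "head G e = 2" "lab e = 1" by (rule edge_ex)
  then have "e \<in> sources" "pos e = 1" by (auto simp: sources_def pos_def level_2)
  then have one: "1 \<in> path_I \<nu>" unfolding pos_image[symmetric] by force
  have "card A + 1 = card (path_I \<nu>) + card (path_J \<nu>)"
  proof (rule card_maximal_noncrossing[OF finite_paths])
    show "1 \<in> path_I \<nu>" by (rule one)
    show "1 < j" if "j \<in> path_J \<nu>" for j using that by (auto simp: path_J_eq level_def)
    show "level \<nu> (a + 2) \<in> path_J \<nu>" by (simp add: path_J_eq)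
    show "i < level \<nu> (a + 2)" if "i \<in> path_I \<nu>" for i using that by (simp add: path_I_iff)
  qed (use A in \<open>auto simp: facets_def\<close>)
  then show ?thesis by (simp add: card_path_I card_path_J)
qed

lemma card_face_le: "A \<in> K \<Longrightarrow> card A \<le> a + sum_list \<nu> + 1"
proof -
  assume "A \<in> K"
  then obtain B where B: "B \<in> facets" "A \<subseteq> B" by (rule face_in_facet)
  then have "B \<subseteq> X" by (simp add: facets_def tamari_complex_iff)
  then have "finite B" using finite_X by (rule finite_subset)
  then show ?thesis using card_facet[OF B(1)] card_mono[OF _ B(2)] by simp
qed

lemma complex_dim_K: "complex_dim K = int (a + sum_list \<nu>)"
proof -
  have "{} \<in> K" by (simp add: tamari_complex_iff)
  then obtain B where B: "B \<in> facets" by (rule face_in_facet)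
  have "Max (card ` K) = a + sum_list \<nu> + 1"
    by (rule Max_eqI) (use finite_tamari_complex[OF finite_paths] card_face_le card_facet[OF B] B in
      \<open>auto simp: facets_def intro!: image_eqI[of _ card B]\<close>)
  then show ?thesis by (simp add: complex_dim_def)
qed

lemma top_simplices_eq:
  "length_framed_top_simplices \<nu> G lab = (\<lambda>A. convex hull (place ` A)) ` facets"
proof -
  interpret barycentric_placement K place by (rule placement)
  have inj: "inj_on route_of X"
    using inj_placement unfolding Union_tamari_complex
    by (auto simp: inj_on_def place_def)
  have sub: "A \<subseteq> X" if "A \<in> K" for A using that by (simp add: tamari_complex_iff)
  have "{C. maximal_clique G 1 (a + 3) (length_in G lab) (length_out G lab) C} = (`) route_of ` facets"
  proof (intro equalityI subsetI)
    fix C assume "C \<in> {C. maximal_clique G 1 (a + 3) (length_in G lab) (length_out G lab) C}"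
    then have max_clique: "\<exists>A\<in>K. C = route_of ` A"
      "\<And>D. \<exists>A\<in>K. D = route_of ` A \<Longrightarrow> C \<subseteq> D \<Longrightarrow> D = C"
      unfolding maximal_clique_def clique_iff by blast+
    then obtain A where A: "A \<in> K" "C = route_of ` A" by blast
    have max: "route_of ` B = C" if "B \<in> K" "C \<subseteq> route_of ` B" for B
      using max_clique(2)[of "route_of ` B"] that by blast
    have "B = A" if "B \<in> K" "A \<subseteq> B" for B
      using max[OF that(1)] that A sub inj_on_image_eq_iff[OF inj] by (simp add: image_mono)
    then show "C \<in> (`) route_of ` facets" using A by (auto simp: facets_def)
  next
    fix C assume "C \<in> (`) route_of ` facets"
    then obtain A where A: "A \<in> K" "C = route_of ` A" "\<And>B. B \<in> K \<Longrightarrow> A \<subseteq> B \<Longrightarrow> B = A"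
      by (auto simp: facets_def)
    have "route_of ` B = C" if "B \<in> K" "C \<subseteq> route_of ` B" for B
    proof -
      have "A \<subseteq> B"
        using that(2) inj_on_image_subset_iff[OF inj sub[OF A(1)] sub[OF that(1)]]
        unfolding A(2) by simp
      then show ?thesis using A(2) A(3)[OF that(1)] by simp
    qed
    then show "C \<in> {C. maximal_clique G 1 (a + 3) (length_in G lab) (length_out G lab) C}"
      unfolding maximal_clique_def clique_iff using A(1,2) by auto
  qed
  then show ?thesis
    unfolding length_framed_top_simplices_def framed_top_simplices_def clique_simplex_def
    by (simp add: image_image place_def)
qed

lemma triangulation_eq:
  "length_framed_triangulation \<nu> G lab = (\<lambda>A. convex hull (place ` A)) ` K"
proof -
  interpret barycentric_placement K place by (rule placement)
  have "length_framed_triangulation \<nu> G lab =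
    {S. \<exists>A\<in>facets. S face_of (convex hull (place ` A))}"
    using top_simplices_eq
    unfolding length_framed_triangulation_def length_framed_top_simplices_def framed_triangulation_def
    by simp
  also have "\<dots> = {S. \<exists>A\<in>facets. \<exists>B\<subseteq>A. S = convex hull (place ` B)}"
    using face_of_hull_iff by (auto simp: facets_def)
  also have "\<dots> = (\<lambda>A. convex hull (place ` A)) ` K"
  proof (intro equalityI subsetI)
    fix S assume "S \<in> {S. \<exists>A\<in>facets. \<exists>B\<subseteq>A. S = convex hull (place ` B)}"
    then show "S \<in> (\<lambda>A. convex hull (place ` A)) ` K"
      using subface by (auto simp: facets_def)
  next
    fix S assume "S \<in> (\<lambda>A. convex hull (place ` A)) ` K"
    then obtain B where B: "B \<in> K" "S = convex hull (place ` B)" by blast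
    from B(1) obtain A where "A \<in> facets" "B \<subseteq> A" by (rule face_in_facet)
    then show "S \<in> {S. \<exists>A\<in>facets. \<exists>B\<subseteq>A. S = convex hull (place ` B)}"
      using B(2) by blast
  qed
  finally show ?thesis .
qed

lemma convex_flow_polytope: "convex (flow_polytope G 1 (a + 3))"
proof -
  have "convex {x :: real^'e. (\<forall>e. 0 \<le> x $ e) \<and> (\<Sum>e\<in>sources. x $ e) = 1}"
    by (rule convexI) (simp add: sum.distrib sum_distrib_left[symmetric])
  moreover have "convex conserved" by (rule subspace_imp_convex) (rule subspace_conserved)
  ultimately have "convex ({x :: real^'e. (\<forall>e. 0 \<le> x $ e) \<and> (\<Sum>e\<in>sources. x $ e) = 1} \<inter> conserved)"
    by (rule convex_Int)
  moreover have "flow_polytope G 1 (a + 3) =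
    {x. (\<forall>e. 0 \<le> x $ e) \<and> (\<Sum>e\<in>sources. x $ e) = 1} \<inter> conserved"
    unfolding flow_polytope_eq by auto
  ultimately show ?thesis by simp
qed

lemma Union_triangulation:
  "\<Union>(length_framed_triangulation \<nu> G lab) = flow_polytope G 1 (a + 3)"
proof
  show "\<Union>(length_framed_triangulation \<nu> G lab) \<subseteq> flow_polytope G 1 (a + 3)"
  proof -
    have "convex hull (place ` A) \<subseteq> flow_polytope G 1 (a + 3)" if "A \<in> K" for A
    proof (rule hull_minimal)
      have "A \<subseteq> X" using that by (simp add: tamari_complex_iff)
      then show "place ` A \<subseteq> flow_polytope G 1 (a + 3)" using place_entries(3) by blast
    qed (rule convex_flow_polytope)
    then show ?thesis unfolding triangulation_eq by blast
  qed
  show "flow_polytope G 1 (a + 3) \<subseteq> \<Union>(length_framed_triangulation \<nu> G lab)"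
    unfolding triangulation_eq using polytope_point_in_face by blast
qed

lemma flow_polytope_conserved: "flow_polytope G 1 (a + 3) \<subseteq> conserved"
  unfolding flow_polytope_eq by blast

section \<open>Projection to few coordinates\<close>

lemma affine_hull_polytope: "affine hull (flow_polytope G 1 (a + 3)) \<subseteq> conserved"
  by (rule hull_minimal[where S = affine, OF flow_polytope_conserved
        subspace_imp_affine[OF subspace_conserved]])

lemma coord_proj_inj_on_conserved:
  assumes "sources \<union> exit_edge ` {2..a + 2} \<subseteq> range c"
  shows "inj_on (coord_proj c) conserved"
proof (rule inj_onI)
  fix x y assume xy: "x \<in> conserved" "y \<in> conserved" "coord_proj c x = coord_proj c y"
  have eq: "x $ e = y $ e" if "e \<in> range c" for e
    using that xy(3) by (auto simp: coord_proj_def vec_eq_iff)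
  show "x = y"
    by (rule conserved_eqI[OF xy(1,2)]) (use assms eq in \<open>auto simp: subset_iff\<close>)
qed

text \<open>
  The edges at the source and at the sink separate conserved vectors, and there are \<open>a + b + 2\<close> of them.
  The unit edge leaving vertex \<open>2\<close> fills up the required number of coordinates; it is an inner edge
  because \<open>a \<ge> 1\<close>.
\<close>

lemma coordinates_exist:
  assumes "\<nu> \<noteq> []" and "CARD('d) = a + sum_list \<nu> + 3"
  obtains c :: "'d::finite \<Rightarrow> 'e" where "inj c" "sources \<union> exit_edge ` {2..a + 2} \<subseteq> range c"
proof -
  let ?R = "insert (link_edge 2) (sources \<union> exit_edge ` {2..a + 2})"
  have a: "1 \<le> a" using assms(1) by (cases \<nu>) auto
  have l: "tail G (link_edge 2) = 2" using link_edge[of 2] a by simp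
  have inj: "inj_on exit_edge {2..a + 2}"
    by (rule inj_on_inverseI[of _ "tail G"]) (simp add: exit_edge)
  have disj: "sources \<inter> exit_edge ` {2..a + 2} = {}"
    by (auto simp: sources_def exit_edge)
  have "link_edge 2 \<notin> sources \<union> exit_edge ` {2..a + 2}"
    using l a exit_neq_link[of _ 2] by (auto simp: sources_def dest: sym)
  then have "card ?R = Suc (card sources + card (exit_edge ` {2..a + 2}))"
    using disj by (simp add: card_Un_disjoint)
  also have "\<dots> = a + sum_list \<nu> + 3"
    using card_image[OF inj] by (simp add: card_sources)
  finally have "card (UNIV :: 'd set) = card ?R" using assms(2) by simp
  then obtain c :: "'d \<Rightarrow> 'e" where "bij_betw c UNIV ?R"
    using finite_same_card_bij[of "UNIV :: 'd set" ?R] by auto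
  then show thesis using that by (auto simp: bij_betw_def)
qed

end

lemma linear_coord_proj: "linear (coord_proj c)"
  by (rule linearI) (auto simp: coord_proj_def vec_eq_iff)

theorem corollary4p11:
  fixes a b :: nat
    and \<nu> :: "nat list"
    and G :: "(nat, 'e::finite) pre_digraph"
    and lab :: "'e \<Rightarrow> nat"
  assumes "a \<ge> 1"
    and "length \<nu> = a"
    and "sum_list \<nu> = b"
    and "is_caracol \<nu> G lab"
    and "CARD('d::finite) = a + b + 3"
  defines "F \<equiv> flow_polytope G 1 (a + 3)"
    and "\<T> \<equiv> length_framed_triangulation \<nu> G lab"
    and "K \<equiv> tamari_complex (path_I \<nu>) (path_J \<nu>)"
  shows "geometric_realization \<T> K \<and>
         \<Union>\<T> = F \<and>
         complex_dim K = int (a + b) \<and>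
         (\<forall>\<Delta> \<in> length_framed_top_simplices \<nu> G lab. int (a + b) simplex \<Delta>) \<and>
         (\<exists>c :: 'd \<Rightarrow> 'e. inj c \<and> inj_on (coord_proj c) (affine hull F) \<and>
            geometric_realization ((`) (coord_proj c) ` \<T>) K)"
proof (intro conjI ballI)
  interpret caracol \<nu> G lab by unfold_locales (rule assms(4))
  interpret P: barycentric_placement K place unfolding K_def by (rule placement)
  have T: "\<T> = (\<lambda>A. convex hull (place ` A)) ` K"
    unfolding \<T>_def K_def by (rule triangulation_eq)
  show "geometric_realization \<T> K" unfolding T by (rule P.hulls_realize)
  show "\<Union>\<T> = F" unfolding \<T>_def F_def assms(2)[symmetric] by (rule Union_triangulation)
  show "complex_dim K = int (a + b)"
    unfolding K_def assms(2)[symmetric] assms(3)[symmetric] by (rule complex_dim_K)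
  show "int (a + b) simplex \<Delta>" if \<Delta>: "\<Delta> \<in> length_framed_top_simplices \<nu> G lab" for \<Delta>
  proof -
    obtain A where A: "A \<in> facets" "\<Delta> = convex hull (place ` A)"
      using \<Delta> unfolding top_simplices_eq by blast
    then have "A \<in> K" by (simp add: facets_def K_def)
    from P.face_simplex[OF this] show ?thesis using card_facet[OF A(1)] A(2) assms(2,3) by simp
  qed
  have "\<nu> \<noteq> []" using assms(1,2) by auto
  moreover have "CARD('d) = length \<nu> + sum_list \<nu> + 3" using assms by simp
  ultimately obtain c :: "'d \<Rightarrow> 'e"
    where c: "inj c" "sources \<union> exit_edge ` {2..length \<nu> + 2} \<subseteq> range c"
    by (rule coordinates_exist)
  have inj: "inj_on (coord_proj c) conserved" using c(2) by (rule coord_proj_inj_on_conserved)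
  have "inj_on (coord_proj c) (affine hull F)"
    using inj_on_subset[OF inj affine_hull_polytope] unfolding F_def assms(2) .
  moreover have "barycentric_placement K (coord_proj c \<circ> place)"
  proof (rule barycentric_placement_linear_image[OF P.barycentric_placement_axioms
        linear_coord_proj inj subspace_conserved])
    show "place ` \<Union>K \<subseteq> conserved"
      using place_entries(3) flow_polytope_conserved unfolding K_def Union_tamari_complex by blast
  qed
  then have "geometric_realization ((\<lambda>A. convex hull ((coord_proj c \<circ> place) ` A)) ` K) K"
    by (rule barycentric_placement.hulls_realize)
  moreover have "(\<lambda>A. convex hull ((coord_proj c \<circ> place) ` A)) ` K = (`) (coord_proj c) ` \<T>"
    unfolding T
    by (simp add: image_image convex_hull_linear_image[OF linear_coord_proj])
  ultimately show "\<exists>c :: 'd \<Rightarrow> 'e. inj c \<and> inj_on (coord_proj c) (affine hull F) \<and>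
      geometric_realization ((`) (coord_proj c) ` \<T>) K"
    using c(1) by auto
qed

end
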